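(* Let $k\in\{2,\dots,p\}$, $m\ge1$, and let the damping parameter $\omega_k$ satisfy $0<\omega_k\,\rho(\mathbb{D}_k^{-1}\mathbb{A}_k)\le1$. Suppose $\omega_k\lesssim(k+1)^{-1}$. Then $$\big\|\mathbb{M}_k^{-\frac12}\mathbb{A}_kP_m(\omega_k\mathbb{D}_k^{-1}\mathbb{A}_k)\mathbf{g}_k\big\|_{\mathbb{A}_k,0}\lesssim\frac{k^2}{h\,m}\,\|\mathbf{g}_k\|_{\mathbb{A}_k,1}\qquad\forall\,\mathbf{g}_k\in\mathbb{R}^{N_hN_k}.$$
   Context: Setting. $\Omega\subset\mathbb{R}^d$ is an axis-parallel open rectangular box, $\mathcal{T}_h$ a uniform Cartesian mesh of $\Omega$ by $N_h$ cubes (intervals/squares if $d=1,2$) of edge length $h$, and $\mathcal{F}_h$ the set of all interior and boundary faces. For $T\in\mathcal{T}_h$ with affine map $\boldsymbol{F}_T:[-1,1]^d\to T$ and $\boldsymbol\sigma\in\mathbb{N}^d$ let $\Psi_T^{\boldsymbol\sigma}(\boldsymbol{x})=\prod_{i=1}^d l_{\sigma_i}(\xi_i)$, $\boldsymbol\xi=\boldsymbol{F}_T^{-1}(\boldsymbol{x})$, where $l_n$ is the Legendre polynomial of degree $n$ with $l_n(1)=1$; $\Psi_T^{\boldsymbol\sigma}$ is extended by zero outside $T$. $U_k(\mathcal{T}_h)=\mathrm{span}\{\Psi_T^{\boldsymbol\sigma}:\|\boldsymbol\sigma\|_\infty\le k,\ T\in\mathcal{T}_h\}$; $N_k=(k+1)^d$.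 Levels are $k=1,\dots,p$. A function $v_k\in U_k(\mathcal{T}_h)$ is identified with its coefficient vector $\mathbf{v}_k\in\mathbb{R}^{N_hN_k}$ in this basis. On an interior face $F=T_1\cap T_2$: $\{\!\{u\}\!\}=\frac12(u|_{T_1}+u|_{T_2})$, $[\![u]\!]=u|_{T_1}-u|_{T_2}$, and $\boldsymbol{n}$ is the unit normal from $T_1$ to $T_2$ (fixed orientation); on a boundary face $\{\!\{u\}\!\}=[\![u]\!]=u$ and $\boldsymbol{n}$ is the outward unit normal. For $u,v\in U_k(\mathcal{T}_h)$, $$\mathcal{A}_k(u,v)=\sum_{T}\int_T\nabla u\cdot\nabla v-\sum_{F\in\mathcal{F}_h}\int_F\{\!\{\nabla u\}\!\}\cdot\boldsymbol{n}\,[\![v]\!]-\sum_{F\in\mathcal{F}_h}\int_F\{\!\{\nabla v\}\!\}\cdot\boldsymbol{n}\,[\![u]\!]+\sum_{F\in\mathcal{F}_h}\frac{\alpha_0k^2}{h}\int_F[\![u]\!][\![v]\!],$$ where $\alpha_0>0$ is a fixed constant, large enough that $\mathcal{A}_k$ is coercive and continuous, uniformly in $h$ and $k$, in the norm $\|v\|_{1,k,h}^2=\sum_T\|\nabla v\|_{L^2(T)}^2+\frac{k^2}{h}\sum_F\|[\![v]\!]\|_{L^2(F)}^2$. The symmetric positive definite matrix $\mathbb{A}_k$ is defined by $\mathbf{v}_k^\top\mathbb{A}_k\mathbf{w}_k=\mathcal{A}_k(v_k,w_k)$; $\mathbb{D}_k$ is the diagonal part of $\mathbb{A}_k$; $\mathbb{M}_k$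 is the (diagonal) mass matrix, $\mathbf{v}_k^\top\mathbb{M}_k\mathbf{w}_k=\int_\Omega v_kw_k$; $\|\mathbf{v}\|_{\mathbb{A}_k,s}^2=\mathbf{v}^\top\mathbb{A}_k^s\mathbf{v}$ (so $s=0$ is the Euclidean norm); $\rho$ is the spectral radius. $P_m$ is the polynomial given by $P_0=1$, $P_1(x)=1-\frac43x$, $P_i(x)=\frac{4i-2}{2i+1}(1-2x)P_{i-1}(x)-\frac{2i-3}{2i+1}P_{i-2}(x)$ for $i\ge2$; $P_m(\omega_k\mathbb{D}_k^{-1}\mathbb{A}_k)$ is the iteration matrix of $m$ steps of the fourth-kind Chebyshev smoother with damping parameter $\omega_k$. $x\lesssim y$ means $x\le Cy$ for a constant $C>0$ independent of the mesh size $h$ and the polynomial degrees (and of $m$).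
   Formalization: The damping parameter is assumed to be of exact order (k+1)^{-1}: besides ω_k ≲ (k+1)^{-1}, the lower bound ω_k ≳ (k+1)^{-1} is required, since for ω_k → 0 the matrix P_m tends to the identity and the stated bound with a constant independent of m fails. *)

theory Defs
  imports
    "HOL-Analysis.Analysis"
    "HOL-Computational_Algebra.Polynomial"
    "Jordan_Normal_Form.Matrix"
    "Jordan_Normal_Form.Spectral_Radius"
begin

no_notation Matrix.vec_index (infixl \<open>$\<close> 100)
no_notation Matrix.scalar_prod (infix \<open>\<bullet>\<close> 70)

fun legendre :: "nat \<Rightarrow> real poly" where
  "legendre 0 = 1"
| "legendre (Suc 0) = [:0, 1:]"
| "legendre (Suc (Suc n)) =
     Polynomial.smult ((2 * real n + 3) / (real n + 2)) ([:0, 1:] * legendre (Suc n))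
     - Polynomial.smult ((real n + 1) / (real n + 2)) (legendre n)"

text \<open>
  The box is \<open>box a b\<close>, and \<open>N i\<close> is the number of cells in direction \<open>i\<close>. A cell is named by its
  integer position \<open>z\<close>, with \<open>z i < N i\<close>.
\<close>

definition uniform_mesh ::
    "real ^ 'n \<Rightarrow> real ^ 'n \<Rightarrow> real \<Rightarrow> ('n::finite \<Rightarrow> nat) \<Rightarrow> bool" where
  "uniform_mesh a b h N \<longleftrightarrow>
     0 < h \<and> (\<forall>i. 0 < N i \<and> b $ i = a $ i + real (N i) * h)"

definition cells :: "('n::finite \<Rightarrow> nat) \<Rightarrow> ('n \<Rightarrow> nat) set" where
  "cells N = {z. \<forall>i. z i < N i}"

definition cell :: "real ^ 'n \<Rightarrow> real \<Rightarrow> ('n::finite \<Rightarrow> nat) \<Rightarrow> (real ^ 'n) set" where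
  "cell a h z = cbox (\<chi> i. a $ i + real (z i) * h) (\<chi> i. a $ i + (real (z i) + 1) * h)"

definition cell_map_inv ::
    "real ^ 'n \<Rightarrow> real \<Rightarrow> ('n::finite \<Rightarrow> nat) \<Rightarrow> real ^ 'n \<Rightarrow> real ^ 'n" where
  "cell_map_inv a h z x = (\<chi> i. 2 * (x $ i - (a $ i + real (z i) * h)) / h - 1)"

text \<open>
  A broken function is encoded by the family of its restrictions to the cells. Each restriction is
  a polynomial taken on the whole space, so that its values and gradients at points of a face of
  the cell are the traces from that cell.
\<close>

type_synonym 'n broken = "('n \<Rightarrow> nat) \<Rightarrow> real ^ 'n \<Rightarrow> real"

definition dg_index :: "('n::finite \<Rightarrow> nat) \<Rightarrow> nat \<Rightarrow> (('n \<Rightarrow> nat) \<times> ('n \<Rightarrow> nat)) set" where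
  "dg_index N k = cells N \<times> {\<sigma>. \<forall>i. \<sigma> i \<le> k}"

definition dg_basis ::
    "real ^ 'n \<Rightarrow> real \<Rightarrow> ('n \<Rightarrow> nat) \<times> ('n \<Rightarrow> nat) \<Rightarrow> ('n::finite) broken" where
  "dg_basis a h s = (\<lambda>z x. if z = fst s
     then \<Prod>i\<in>UNIV. poly (legendre (snd s i)) (cell_map_inv a h (fst s) x $ i) else 0)"

definition dg_space ::
    "real ^ 'n \<Rightarrow> real \<Rightarrow> ('n \<Rightarrow> nat) \<Rightarrow> nat \<Rightarrow> ('n::finite) broken set" where
  "dg_space a h N k =
     {(\<lambda>z x. \<Sum>s\<in>dg_index N k. c s * dg_basis a h s z x) | c. True}"

definition grad :: "(real ^ 'n \<Rightarrow> real) \<Rightarrow> real ^ 'n \<Rightarrow> real ^ 'n::finite" where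
  "grad f x = (\<chi> i. frechet_derivative f (at x) (axis i 1))"

text \<open>
  The pair \<open>(i, z)\<close> names the face orthogonal to the \<open>i\<close>-th axis in the hyperplane
  \<open>x $ i = a $ i + z i * h\<close>. Its neighbours are the cell \<open>z(i := z i - 1)\<close>, which exists iff
  \<open>z i > 0\<close>, and the cell \<open>z\<close>, which exists iff \<open>z i < N i\<close>. Interior faces are oriented in the
  direction of increasing \<open>x $ i\<close>.
\<close>

definition faces :: "('n::finite \<Rightarrow> nat) \<Rightarrow> ('n \<times> ('n \<Rightarrow> nat)) set" where
  "faces N = {(i, z). z i \<le> N i \<and> (\<forall>j. j \<noteq> i \<longrightarrow> z j < N j)}"

definition face_avg ::
    "('n::finite \<Rightarrow> nat) \<Rightarrow> 'n \<times> ('n \<Rightarrow> nat) \<Rightarrow>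
     (('n \<Rightarrow> nat) \<Rightarrow> real ^ 'n \<Rightarrow> 'b::real_vector) \<Rightarrow> real ^ 'n \<Rightarrow> 'b" where
  "face_avg N F u x = (case F of (i, z) \<Rightarrow>
     if z i = 0 then u z x
     else if z i = N i then u (z(i := z i - 1)) x
     else (1/2) *\<^sub>R (u (z(i := z i - 1)) x + u z x))"

definition face_jump ::
    "('n::finite \<Rightarrow> nat) \<Rightarrow> 'n \<times> ('n \<Rightarrow> nat) \<Rightarrow> 'n broken \<Rightarrow> real ^ 'n \<Rightarrow> real" where
  "face_jump N F u x = (case F of (i, z) \<Rightarrow>
     if z i = 0 then u z x
     else if z i = N i then u (z(i := z i - 1)) x
     else u (z(i := z i - 1)) x - u z x)"

definition face_normal :: "'n \<times> ('n \<Rightarrow> nat) \<Rightarrow> real ^ 'n::finite" where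
  "face_normal F = (case F of (i, z) \<Rightarrow> if z i = 0 then - axis i 1 else axis i 1)"

text \<open>
  The surface measure of a face is the product Lebesgue measure in the remaining coordinates; in
  dimension one it is the unit mass at the point.
\<close>

definition face_integral ::
    "real ^ 'n \<Rightarrow> real \<Rightarrow> 'n \<times> ('n::finite \<Rightarrow> nat) \<Rightarrow> (real ^ 'n \<Rightarrow> real) \<Rightarrow> real" where
  "face_integral a h F f = (case F of (i, z) \<Rightarrow>
     set_lebesgue_integral (PiM (UNIV - {i}) (\<lambda>_. lborel))
       (PiE (UNIV - {i}) (\<lambda>j. {a $ j + real (z j) * h .. a $ j + (real (z j) + 1) * h}))
       (\<lambda>y. f (\<chi> j. if j = i then a $ i + real (z i) * h else y j)))"

definition cell_integral ::
    "real ^ 'n \<Rightarrow> real \<Rightarrow> ('n::finite \<Rightarrow> nat) \<Rightarrow> (real ^ 'n \<Rightarrow> real) \<Rightarrow> real" where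
  "cell_integral a h z f = set_lebesgue_integral lborel (cell a h z) f"

definition dg_form ::
    "real \<Rightarrow> real ^ 'n \<Rightarrow> real \<Rightarrow> ('n::finite \<Rightarrow> nat) \<Rightarrow> nat \<Rightarrow>
     'n broken \<Rightarrow> 'n broken \<Rightarrow> real" where
  "dg_form \<alpha>\<^sub>0 a h N k u v =
     (\<Sum>z\<in>cells N. cell_integral a h z (\<lambda>x. grad (u z) x \<bullet> grad (v z) x))
     - (\<Sum>F\<in>faces N. face_integral a h F
          (\<lambda>x. (face_avg N F (\<lambda>z. grad (u z)) x \<bullet> face_normal F) * face_jump N F v x))
     - (\<Sum>F\<in>faces N. face_integral a h F
          (\<lambda>x. (face_avg N F (\<lambda>z. grad (v z)) x \<bullet> face_normal F) * face_jump N F u x))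
     + (\<Sum>F\<in>faces N. \<alpha>\<^sub>0 * (real k)\<^sup>2 / h *
          face_integral a h F (\<lambda>x. face_jump N F u x * face_jump N F v x))"

definition dg_norm ::
    "real ^ 'n \<Rightarrow> real \<Rightarrow> ('n::finite \<Rightarrow> nat) \<Rightarrow> nat \<Rightarrow> 'n broken \<Rightarrow> real" where
  "dg_norm a h N k v = sqrt (
     (\<Sum>z\<in>cells N. cell_integral a h z (\<lambda>x. (norm (grad (v z) x))\<^sup>2))
     + (real k)\<^sup>2 / h * (\<Sum>F\<in>faces N. face_integral a h F (\<lambda>x. (face_jump N F v x)\<^sup>2)))"

definition l2_form ::
    "real ^ 'n \<Rightarrow> real \<Rightarrow> ('n::finite \<Rightarrow> nat) \<Rightarrow> 'n broken \<Rightarrow> 'n broken \<Rightarrow> real" where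
  "l2_form a h N u v = (\<Sum>z\<in>cells N. cell_integral a h z (\<lambda>x. u z x * v z x))"

definition uniformly_stable_penalty ::
    "real ^ 'n \<Rightarrow> real ^ 'n::finite \<Rightarrow> real \<Rightarrow> bool" where
  "uniformly_stable_penalty a b \<alpha>\<^sub>0 \<longleftrightarrow>
     (\<exists>c>0. \<exists>C>0. \<forall>h N k. uniform_mesh a b h N \<longrightarrow> 1 \<le> k \<longrightarrow>
        (\<forall>u\<in>dg_space a h N k. c * (dg_norm a h N k u)\<^sup>2 \<le> dg_form \<alpha>\<^sub>0 a h N k u u) \<and>
        (\<forall>u\<in>dg_space a h N k. \<forall>v\<in>dg_space a h N k.
           \<bar>dg_form \<alpha>\<^sub>0 a h N k u v\<bar> \<le> C * dg_norm a h N k u * dg_norm a h N k v))"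

definition dg_dim :: "('n::finite \<Rightarrow> nat) \<Rightarrow> nat \<Rightarrow> nat" where
  "dg_dim N k = card (dg_index N k)"

text \<open>The Gram matrix of a bilinear form in the basis, numbered in some fixed order.\<close>

definition dg_matrix ::
    "real ^ 'n \<Rightarrow> real \<Rightarrow> ('n::finite \<Rightarrow> nat) \<Rightarrow> nat \<Rightarrow>
     ('n broken \<Rightarrow> 'n broken \<Rightarrow> real) \<Rightarrow> real mat" where
  "dg_matrix a h N k B = Matrix.mat (dg_dim N k) (dg_dim N k)
     (\<lambda>(r, s). B (dg_basis a h (from_nat_into (dg_index N k) r))
                 (dg_basis a h (from_nat_into (dg_index N k) s)))"

definition stiffness ::
    "real \<Rightarrow> real ^ 'n \<Rightarrow> real \<Rightarrow> ('n::finite \<Rightarrow> nat) \<Rightarrow> nat \<Rightarrow> real mat" where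
  "stiffness \<alpha>\<^sub>0 a h N k = dg_matrix a h N k (dg_form \<alpha>\<^sub>0 a h N k)"

definition mass :: "real ^ 'n \<Rightarrow> real \<Rightarrow> ('n::finite \<Rightarrow> nat) \<Rightarrow> nat \<Rightarrow> real mat" where
  "mass a h N k = dg_matrix a h N k (l2_form a h N)"

definition diag_part :: "real mat \<Rightarrow> real mat" where
  "diag_part A = mat_diag (dim_row A) (\<lambda>i. A $$ (i, i))"

text \<open>
  Only for diagonal matrices with positive diagonal; the mass matrix is one, because the tensor
  Legendre basis is orthogonal in \<open>L\<^sup>2\<close>.
\<close>

definition diag_powr :: "real mat \<Rightarrow> real \<Rightarrow> real mat" where
  "diag_powr A s = mat_diag (dim_row A) (\<lambda>i. (A $$ (i, i)) powr s)"

definition energy_norm :: "real mat \<Rightarrow> nat \<Rightarrow> real Matrix.vec \<Rightarrow> real" where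
  "energy_norm A s v = sqrt (scalar_prod v ((A ^\<^sub>m s) *\<^sub>v v))"

definition mat_spectral_radius :: "real mat \<Rightarrow> real" where
  "mat_spectral_radius A = spectral_radius (map_mat complex_of_real A)"

definition poly_mat :: "real poly \<Rightarrow> real mat \<Rightarrow> real mat" where
  "poly_mat p X = Matrix.mat (dim_row X) (dim_row X)
     (\<lambda>(r, s). \<Sum>t\<le>Polynomial.degree p. Polynomial.coeff p t * (X ^\<^sub>m t) $$ (r, s))"

text \<open>
  As \<open>\<omega> \<rightarrow> 0\<close> the matrix \<open>poly_mat (cheb4 m) (\<omega> \<cdot>\<^sub>m X)\<close> tends to the identity for every \<open>m\<close>.
  A smoothing estimate with a constant independent of \<open>m\<close> therefore needs a lower bound on \<open>\<omega>\<close>.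
\<close>

fun cheb4 :: "nat \<Rightarrow> real poly" where
  "cheb4 0 = 1"
| "cheb4 (Suc 0) = [:1, - (4/3):]"
| "cheb4 (Suc (Suc n)) = (let i = real (Suc (Suc n)) in
     Polynomial.smult ((4 * i - 2) / (2 * i + 1)) ([:1, - 2:] * cheb4 (Suc n))
     - Polynomial.smult ((2 * i - 3) / (2 * i + 1)) (cheb4 n))"

end

theory Submission
  imports Defs
begin

text \<open>
  Write \<open>D\<close> for the diagonal of \<open>A\<close> and \<open>Z = \<omega> D\<^sup>-\<^sup>1 A\<close>, which is self-adjoint for \<open>\<langle>u, v\<rangle> = u\<^sup>T D v\<close>, nonnegative
  by coercivity and at most the identity by the condition on the spectral radius. With
  \<open>W = (2 m + 1) P\<^sub>m\<close> and the third-kind companion \<open>V\<close> one has \<open>x W\<^sup>2 + (1 - x) V\<^sup>2 = 1\<close>. Multiplied by \<open>x\<close>,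
  this is a sum-of-squares certificate for \<open>\<langle>Z W(Z) g, Z W(Z) g\<rangle> \<le> \<langle>g, Z g\<rangle> = \<omega> g\<^sup>T A g\<close>, the gain of \<open>1/m\<close>.

  The passage from \<open>M\<close> to \<open>D\<close> costs the maximum of \<open>D\<^sub>s\<^sub>s / M\<^sub>s\<^sub>s\<close>. By continuity this is bounded by the
  squared DG norm of a basis function relative to its squared \<open>L\<^sup>2\<close> norm. The integrals of \<open>l\<^sub>n\<^sup>2\<close> and
  \<open>l\<^sub>n'\<^sup>2\<close> over \<open>[-1, 1]\<close> are \<open>2 / (2 n + 1)\<close> and \<open>n (n + 1)\<close>, and \<open>l\<^sub>n(\<plusminus>1)\<^sup>2 = 1\<close>, so the ratio is of order
  \<open>k\<^sup>3 / h\<^sup>2\<close>; the last factor \<open>k\<close> is \<open>1 / \<omega>\<close>.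
\<close>

section \<open>Legendre polynomials\<close>

lemma legendre_Suc_Suc_smult:
  "Polynomial.smult (real n + 2) (legendre (Suc (Suc n))) =
     Polynomial.smult (2 * real n + 3) ([:0, 1:] * legendre (Suc n)) - Polynomial.smult (real n + 1) (legendre n)"
proof -
  have "real n + 2 \<noteq> 0" by linarith
  then show ?thesis
    by (simp add: smult_diff_right)
qed

lemma legendre_poly_Suc_Suc:
  "(real n + 2) * poly (legendre (Suc (Suc n))) x =
     (2 * real n + 3) * x * poly (legendre (Suc n)) x - (real n + 1) * poly (legendre n) x"
  using arg_cong[OF legendre_Suc_Suc_smult, of "\<lambda>p. poly p x" n]
  by (simp del: legendre.simps add: mult.assoc)

lemma legendre_pderiv_Suc_Suc:
  "(real n + 2) * poly (pderiv (legendre (Suc (Suc n)))) x =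
     (2 * real n + 3) * (poly (legendre (Suc n)) x + x * poly (pderiv (legendre (Suc n))) x)
     - (real n + 1) * poly (pderiv (legendre n)) x"
  using arg_cong[OF legendre_Suc_Suc_smult, of "\<lambda>p. poly (pderiv p) x" n]
  by (simp del: legendre.simps add: pderiv_diff pderiv_smult pderiv_mult pderiv_pCons ring_distribs
      mult.assoc)

text \<open>One induction serves both relations: the step of the first uses both at
  \<open>n\<close>, and the step of the second differentiates the three-term recursion and
  eliminates \<open>pderiv (legendre n)\<close> by the first.\<close>

lemma legendre_pderiv_relations:
  shows legendre_pderiv_down: "x * poly (pderiv (legendre (Suc n))) x - poly (pderiv (legendre n)) x
           = (real n + 1) * poly (legendre (Suc n)) x" (is "?A n")
    and legendre_pderiv_up: "poly (pderiv (legendre (Suc n))) x - x * poly (pderiv (legendre n)) x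
           = (real n + 1) * poly (legendre n) x" (is "?B n")
proof -
  have "?A n \<and> ?B n"
  proof (induction n)
    case 0
    show ?case by (simp add: pderiv_pCons)
  next
    case (Suc n)
    let ?p = "poly (legendre (Suc n)) x" and ?q = "poly (legendre n) x"
    let ?p' = "poly (pderiv (legendre (Suc n))) x" and ?q' = "poly (pderiv (legendre n)) x"
    let ?r = "poly (legendre (Suc (Suc n))) x" and ?r' = "poly (pderiv (legendre (Suc (Suc n)))) x"
    have q': "?q' = x * ?p' - (real n + 1) * ?p" using Suc by simp
    have "(real n + 2) * ?r' = (real n + 2) * ((real n + 2) * ?p + x * ?p')"
      unfolding legendre_pderiv_Suc_Suc q' by (simp add: algebra_simps)
    then have r': "?r' = (real n + 2) * ?p + x * ?p'" by simp
    have "?p' - x * ?q' = (real n + 1) * ?q" using Suc by simp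
    then have p': "?p' = x * (x * ?p' - (real n + 1) * ?p) + (real n + 1) * ?q"
      unfolding q' by linarith
    have "x * ?r' - ?p' = (real n + 2) * ?r"
      unfolding r' legendre_poly_Suc_Suc using p' by (simp add: algebra_simps)
    with r' show ?case by (simp add: algebra_simps)
  qed
  then show "?A n" "?B n" by auto
qed

text \<open>Eliminate the derivative of \<open>legendre n\<close> between the two relations. The
  result writes the flux in Legendre's equation without derivatives.\<close>

lemma legendre_pderiv_mult_one_minus_square:
  "(1 - x\<^sup>2) * poly (pderiv (legendre (Suc n))) x =
     (real n + 1) * (poly (legendre n) x - x * poly (legendre (Suc n)) x)"
proof -
  let ?p' = "poly (pderiv (legendre (Suc n))) x" and ?q' = "poly (pderiv (legendre n)) x"
  have "(1 - x\<^sup>2) * ?p' = (?p' - x * ?q') - x * (x * ?p' - ?q')"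
    by (simp add: algebra_simps power2_eq_square)
  also have "\<dots> = (real n + 1) * (poly (legendre n) x - x * poly (legendre (Suc n)) x)"
    unfolding legendre_pderiv_down legendre_pderiv_up by (simp add: algebra_simps del: legendre.simps)
  finally show ?thesis .
qed

text \<open>Adding the upward relation at \<open>Suc n\<close> to the downward one at
  \<open>n\<close> cancels the mixed term. This drives the inductions in steps of two on integrals
  with derivatives.\<close>

lemma legendre_pderiv_Suc_Suc_diff:
  "pderiv (legendre (Suc (Suc n))) = pderiv (legendre n) + Polynomial.smult (2 * real n + 3) (legendre (Suc n))"
proof (rule poly_ext)
  fix x
  show "poly (pderiv (legendre (Suc (Suc n)))) x =
      poly (pderiv (legendre n) + Polynomial.smult (2 * real n + 3) (legendre (Suc n))) x"
    using legendre_pderiv_down[where x = x and n = n] legendre_pderiv_up[where x = x and n = "Suc n"]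
    by (simp del: legendre.simps add: algebra_simps)
qed

text \<open>Legendre's equation in Sturm-Liouville form. For positive \<open>n\<close> the flux is
  \<open>n (l_{n-1} - x l_n)\<close>, and differentiating it leaves exactly the downward
  relation.\<close>

lemma legendre_ode:
  "pderiv ([:1, 0, -1:] * pderiv (legendre n)) = Polynomial.smult (- (real n * (real n + 1))) (legendre n)"
proof (cases n)
  case 0
  then show ?thesis by simp
next
  case (Suc l)
  have eq: "[:1, 0, -1:] * pderiv (legendre n) =
      Polynomial.smult (real n) (legendre l - [:0, 1:] * legendre n)"
    by (rule poly_ext, unfold Suc)
       (use legendre_pderiv_mult_one_minus_square[where n = l] in
         \<open>simp del: legendre.simps add: algebra_simps power2_eq_square\<close>)
  show ?thesis
    unfolding eq
    by (rule poly_ext, unfold Suc)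
      (use legendre_pderiv_down[where n = l] in
         \<open>simp del: legendre.simps add: pderiv_smult pderiv_diff pderiv_mult pderiv_pCons algebra_simps\<close>,
       algebra)
qed

lemma legendre_at_one [simp]: "poly (legendre n) 1 = 1"
proof (induction n rule: legendre.induct)
  case (3 n)
  have "(real n + 2) * poly (legendre (Suc (Suc n))) 1 = real n + 2"
    unfolding legendre_poly_Suc_Suc using 3 by simp
  then show ?case by (simp del: legendre.simps)
qed auto

lemma legendre_at_minus_one [simp]: "poly (legendre n) (-1) = (-1) ^ n"
proof (induction n rule: legendre.induct)
  case (3 n)
  have "(real n + 2) * poly (legendre (Suc (Suc n))) (-1) = (real n + 2) * (-1) ^ n"
    unfolding legendre_poly_Suc_Suc using 3 by (simp add: algebra_simps)
  then show ?case by (simp del: legendre.simps)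
qed auto

section \<open>Integrals of Legendre polynomials over the reference interval\<close>

definition unit_integral :: "real poly \<Rightarrow> real" where
  "unit_integral p = (LINT x:{-1..1}|lborel. poly p x)"

lemma set_integrable_poly: "set_integrable lborel {a..b::real} (poly p)"
  by (intro borel_integrable_atLeastAtMost') (auto intro!: continuous_intros)

lemma unit_integral_add: "unit_integral (p + q) = unit_integral p + unit_integral q"
  by (simp add: unit_integral_def set_integral_add set_integrable_poly)

lemma unit_integral_smult: "unit_integral (Polynomial.smult c p) = c * unit_integral p"
  by (simp add: unit_integral_def)

lemma unit_integral_pderiv: "unit_integral (pderiv p) = poly p 1 - poly p (-1)"
proof -
  have "(\<integral>x. poly (pderiv p) x * indicator {-1..1} x \<partial>lborel) = poly p 1 - poly p (-1)"
    by (rule integral_FTC_Icc_real) (auto intro!: poly_DERIV continuous_intros)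
  then show ?thesis
    by (simp add: unit_integral_def set_lebesgue_integral_def mult.commute)
qed

text \<open>Sturm-Liouville argument: the difference of the two eigenvalues times the product is the
  derivative of a Wronskian with weight \<open>1 - x^2\<close>, which vanishes at both endpoints.
  The eigenvalues \<open>n (n + 1)\<close> are distinct.\<close>

lemma unit_integral_legendre_orthogonal:
  assumes "m \<noteq> n"
  shows "unit_integral (legendre m * legendre n) = 0"
proof -
  let ?w = "[:1, 0, -1:] :: real poly"
  have "pderiv (?w * pderiv (legendre m) * legendre n - legendre m * (?w * pderiv (legendre n)))
      = Polynomial.smult (real n * (real n + 1) - real m * (real m + 1)) (legendre m * legendre n)"
    unfolding pderiv_diff pderiv_mult[of "?w * _"] pderiv_mult[of "legendre m"] legendre_ode
    by (rule poly_ext) (simp add: algebra_simps)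
  then have "(real n * (real n + 1) - real m * (real m + 1)) * unit_integral (legendre m * legendre n) = 0"
    using unit_integral_pderiv[of "?w * pderiv (legendre m) * legendre n - legendre m * (?w * pderiv (legendre n))"]
    by (simp add: unit_integral_smult)
  moreover have "real n * (real n + 1) - real m * (real m + 1) = (real n - real m) * (real n + real m + 1)"
    by (simp add: algebra_simps)
  moreover have "real n + real m + 1 \<noteq> 0"
    by linarith
  ultimately show ?thesis
    using assms by auto
qed

text \<open>A derivative of \<open>legendre m\<close> is a combination of Legendre polynomials of
  degree below \<open>m\<close>, built up two degrees at a time, and each of them is orthogonal to
  \<open>legendre n\<close>.\<close>

lemma unit_integral_legendre_pderiv_orthogonal:
  "m \<le> n \<Longrightarrow> unit_integral (legendre n * pderiv (legendre m)) = 0"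
proof (induction m rule: legendre.induct)
  case 1
  show ?case using unit_integral_smult[of 0] by simp
next
  case 2
  then show ?case
    using unit_integral_legendre_orthogonal[of n 0] by (simp add: pderiv_pCons)
next
  case (3 m)
  then show ?case
    by (simp add: legendre_pderiv_Suc_Suc_diff ring_distribs unit_integral_add unit_integral_smult
        unit_integral_legendre_orthogonal del: legendre.simps)
qed

text \<open>Integrate the derivative of \<open>x l_n^2\<close>. Its boundary term is 2 because
  \<open>l_n^2 = 1\<close> at both endpoints; the downward relation turns the integrand into a
  multiple of \<open>l_n^2\<close> plus a term orthogonal to \<open>l_n\<close>.\<close>

lemma unit_integral_legendre_square:
  "unit_integral (legendre n * legendre n) = 2 / (2 * real n + 1)"
proof (cases n)
  case 0
  then show ?thesis
    using unit_integral_pderiv[of "[:0, 1:]"] by (simp add: pderiv_pCons one_pCons)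
next
  case (Suc l)
  have "pderiv ([:0, 1:] * legendre n * legendre n) =
     Polynomial.smult (2 * real n + 1) (legendre n * legendre n) +
     Polynomial.smult 2 (legendre n * pderiv (legendre l))"
  proof (rule poly_ext)
    fix x :: real
    let ?p = "poly (legendre n) x" and ?p' = "poly (pderiv (legendre n)) x"
    have "x * ?p' = (real l + 1) * ?p + poly (pderiv (legendre l)) x"
      using legendre_pderiv_down[where n = l and x = x] Suc by (simp del: legendre.simps)
    then have "?p * ?p + 2 * (?p * (x * ?p')) =
        (2 * real n + 1) * (?p * ?p) + 2 * (?p * poly (pderiv (legendre l)) x)"
      using Suc by (simp add: algebra_simps del: legendre.simps)
    then show "poly (pderiv ([:0, 1:] * legendre n * legendre n)) x =
        poly (Polynomial.smult (2 * real n + 1) (legendre n * legendre n) +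
          Polynomial.smult 2 (legendre n * pderiv (legendre l))) x"
      by (simp add: pderiv_mult pderiv_pCons algebra_simps)
  qed
  then have "(2 * real n + 1) * unit_integral (legendre n * legendre n) = 2"
    using unit_integral_pderiv[of "[:0, 1:] * legendre n * legendre n"] Suc
      unit_integral_legendre_pderiv_orthogonal[of l n]
    by (simp del: legendre.simps add: unit_integral_add unit_integral_smult flip: power_mult_distrib)
  then show ?thesis
    by (simp add: field_simps)
qed

text \<open>Square the two-step difference of derivatives. The cross term integrates to zero, so
  each step of two adds \<open>2 (2 n + 3)\<close>, the difference between
  \<open>(n + 2) (n + 3)\<close> and \<open>n (n + 1)\<close>.\<close>

lemma unit_integral_legendre_pderiv_square:
  "unit_integral (pderiv (legendre n) * pderiv (legendre n)) = real n * (real n + 1)"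
proof (induction n rule: legendre.induct)
  case 1
  show ?case using unit_integral_smult[of 0] by simp
next
  case 2
  show ?case
    using unit_integral_legendre_square[of 0] by (simp add: pderiv_pCons one_pCons)
next
  case (3 n)
  have eq: "pderiv (legendre (Suc (Suc n))) * pderiv (legendre (Suc (Suc n))) =
     pderiv (legendre n) * pderiv (legendre n)
     + Polynomial.smult (2 * (2 * real n + 3)) (legendre (Suc n) * pderiv (legendre n))
     + Polynomial.smult ((2 * real n + 3)\<^sup>2) (legendre (Suc n) * legendre (Suc n))"
    unfolding legendre_pderiv_Suc_Suc_diff
    by (rule poly_ext) (simp del: legendre.simps add: algebra_simps power2_eq_square)
  have "2 * (real n + 1) + 1 = 2 * real n + 3" by simp
  then show ?case
    unfolding eq unit_integral_add unit_integral_smult "3.IH"(2) unit_integral_legendre_square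
    using unit_integral_legendre_pderiv_orthogonal[of n "Suc n"]
    by (simp del: legendre.simps add: field_simps power2_eq_square)
qed

section \<open>Fourth-kind Chebyshev polynomials and moments\<close>

text \<open>
  With \<open>x = sin\<^sup>2 (t/2)\<close> these are \<open>cos ((n + 1/2) t) / cos (t/2)\<close> and \<open>sin ((n + 1/2) t) / sin (t/2)\<close>,
  and the recursion is the angle addition by \<open>t\<close>.
\<close>

fun cheb3_scaled :: "nat \<Rightarrow> real poly" and cheb4_scaled :: "nat \<Rightarrow> real poly" where
  "cheb3_scaled 0 = 1"
| "cheb3_scaled (Suc n) = [:1, -2:] * cheb3_scaled n - [:0, 2:] * cheb4_scaled n"
| "cheb4_scaled 0 = 1"
| "cheb4_scaled (Suc n) = [:1, -2:] * cheb4_scaled n + [:2, -2:] * cheb3_scaled n"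

text \<open>Eliminating the companion from the coupled recursion leaves one with constant
  coefficients, which can be compared with that of \<open>cheb4\<close>.\<close>

lemma cheb4_scaled_Suc_Suc:
  "cheb4_scaled (Suc (Suc n)) = Polynomial.smult 2 ([:1, -2:] * cheb4_scaled (Suc n)) - cheb4_scaled n"
  by (rule poly_ext) (simp add: algebra_simps)

text \<open>The factor \<open>2 i + 1\<close> clears the denominators of the \<open>cheb4\<close>
  recursion. Its coefficients are then \<open>2 (2 (i - 1) + 1)\<close> and
  \<open>2 (i - 2) + 1\<close>, which are absorbed by the scalings of the two predecessors.\<close>

lemma cheb4_scaled_eq: "cheb4_scaled m = Polynomial.smult (2 * real m + 1) (cheb4 m)"
proof (induction m rule: cheb4.induct)
  case (3 n)
  have "2 * real (Suc (Suc n)) + 1 \<noteq> 0" by linarith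
  then have "Polynomial.smult (2 * real (Suc (Suc n)) + 1) (cheb4 (Suc (Suc n))) =
      Polynomial.smult (4 * real (Suc (Suc n)) - 2) ([:1, -2:] * cheb4 (Suc n))
      - Polynomial.smult (2 * real (Suc (Suc n)) - 3) (cheb4 n)"
    unfolding cheb4.simps Let_def smult_diff_right smult_smult by simp
  also have "\<dots> = Polynomial.smult 2 ([:1, -2:] * cheb4_scaled (Suc n)) - cheb4_scaled n"
    unfolding 3(1)[OF refl] 3(2)[OF refl] by (rule poly_ext) (simp add: algebra_simps del: cheb4.simps)
  finally show ?case by (simp only: cheb4_scaled_Suc_Suc)
qed (auto simp: one_pCons)

text \<open>In the variable \<open>t\<close> the two summands are the squared sine and cosine of
  \<open>(m + 1/2) t\<close>.\<close>

lemma cheb34_pythagoras: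
  "[:0, 1:] * cheb4_scaled m * cheb4_scaled m + [:1, -1:] * cheb3_scaled m * cheb3_scaled m = 1"
proof -
  have "x * (poly (cheb4_scaled m) x)\<^sup>2 + (1 - x) * (poly (cheb3_scaled m) x)\<^sup>2 = 1" for x
  proof (induction m)
    case (Suc m)
    \<comment> \<open>One step of the coupled recursion is a rotation: it preserves the quadratic
      form \<open>x w^2 + (1 - x) v^2\<close>.\<close>
    have "x * ((1 - 2 * x) * w + (2 - 2 * x) * v)\<^sup>2 + (1 - x) * ((1 - 2 * x) * v - 2 * x * w)\<^sup>2
      = x * w\<^sup>2 + (1 - x) * v\<^sup>2" for v w :: real
      by (simp add: algebra_simps power2_eq_square)
    from this[of "poly (cheb4_scaled m) x" "poly (cheb3_scaled m) x"] Suc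
    show ?case by (simp add: algebra_simps)
  qed simp
  then show ?thesis
    by (intro poly_ext) (simp add: algebra_simps power2_eq_square)
qed

text \<open>The Riesz functional of a moment sequence. Polynomial identities can be evaluated under
  it, which takes the place of a spectral decomposition.\<close>

definition moment_functional :: "(nat \<Rightarrow> real) \<Rightarrow> real poly \<Rightarrow> real" where
  "moment_functional \<mu> p = (\<Sum>t\<le>Polynomial.degree p. Polynomial.coeff p t * \<mu> t)"

lemma moment_functional_eq:
  assumes "Polynomial.degree p \<le> n"
  shows "moment_functional \<mu> p = (\<Sum>t\<le>n. Polynomial.coeff p t * \<mu> t)"
  unfolding moment_functional_def
  by (intro sum.mono_neutral_left) (use assms in \<open>auto simp: coeff_eq_0\<close>)

lemma moment_functional_add:
  "moment_functional \<mu> (p + q) = moment_functional \<mu> p + moment_functional \<mu> q"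
proof -
  let ?n = "max (Polynomial.degree p) (Polynomial.degree q)"
  have "Polynomial.degree (p + q) \<le> ?n" by (rule degree_add_le_max)
  then show ?thesis
    by (simp add: moment_functional_eq[of _ ?n] sum.distrib ring_distribs)
qed

lemma moment_functional_smult:
  "moment_functional \<mu> (Polynomial.smult c p) = c * moment_functional \<mu> p"
  by (simp add: moment_functional_eq[of _ "Polynomial.degree p"] degree_smult_le sum_distrib_left
      mult.assoc)

lemma moment_functional_pCons:
  "moment_functional \<mu> (pCons c p) = c * \<mu> 0 + moment_functional (\<lambda>t. \<mu> (Suc t)) p"
proof -
  have "Polynomial.degree (pCons c p) \<le> Suc (Polynomial.degree p)" by (rule degree_pCons_le)
  then show ?thesis
    by (simp add: moment_functional_eq[of _ "Suc (Polynomial.degree p)"] sum.atMost_Suc_shift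
        moment_functional_def del: sum.atMost_Suc)
qed

text \<open>Sequences of the form \<open>\<mu> (s + t)\<close> are Hankel: evaluating the two
  factors in separate indices is the same as evaluating their product. Inner products of two
  polynomials in an operator reduce to this.\<close>

lemma moment_functional_mult:
  "moment_functional \<mu> (p * q) =
     moment_functional (\<lambda>s. moment_functional (\<lambda>t. \<mu> (s + t)) q) p"
proof (induction p arbitrary: \<mu>)
  case 0
  show ?case by (simp add: moment_functional_def)
next
  case (pCons c p)
  show ?case
    by (simp add: moment_functional_add moment_functional_smult moment_functional_pCons pCons.IH)
qed

text \<open>The hypotheses are the localising conditions of a moment sequence on the unit interval.
  The inequality follows once \<open>x\<close> minus the squared term is written in the cones of
  \<open>x p^2\<close> and \<open>(1 - x) p^2\<close>.\<close>

lemma moment_functional_cheb4_bound: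
  assumes pos: "\<And>p. 0 \<le> moment_functional \<mu> ([:0, 1:] * (p * p))"
    and le_one: "\<And>p. 0 \<le> moment_functional \<mu> ([:1, -1:] * (p * p))"
  shows "(2 * real m + 1)\<^sup>2 * moment_functional \<mu> (([:0, 1:] * cheb4 m) * ([:0, 1:] * cheb4 m)) \<le> \<mu> 1"
proof -
  let ?v = "cheb3_scaled m" and ?w = "cheb4_scaled m"
  let ?p = "[:1, -1:] * ?v" and ?q = "[:0, 1:] * ?v"
  have "[:0, 1:] = Polynomial.smult ((2 * real m + 1)\<^sup>2) (([:0, 1:] * cheb4 m) * ([:0, 1:] * cheb4 m))
      + [:0, 1:] * (?p * ?p) + [:1, -1:] * (?q * ?q)"
  proof -
    have "[:0, 1:] = [:0, 1:] * ([:0, 1:] * ?w * ?w + [:1, -1:] * ?v * ?v)"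
      by (simp only: cheb34_pythagoras mult_1_right)
    \<comment> \<open>\<open>x (1 - x) = x (1 - x)\<^sup>2 + (1 - x) x\<^sup>2\<close> puts the remainder in the two cones of the hypotheses.\<close>
    also have "\<dots> = ([:0, 1:] * ?w) * ([:0, 1:] * ?w) + [:0, 1:] * (?p * ?p) + [:1, -1:] * (?q * ?q)"
      by (rule poly_ext) (simp add: algebra_simps)
    also have "([:0, 1:] * ?w) * ([:0, 1:] * ?w) =
        Polynomial.smult ((2 * real m + 1)\<^sup>2) (([:0, 1:] * cheb4 m) * ([:0, 1:] * cheb4 m))"
      unfolding cheb4_scaled_eq by (rule poly_ext) (simp add: algebra_simps power2_eq_square)
    finally show ?thesis .
  qed
  then have "moment_functional \<mu> [:0, 1:] = moment_functional \<mu>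
      (Polynomial.smult ((2 * real m + 1)\<^sup>2) (([:0, 1:] * cheb4 m) * ([:0, 1:] * cheb4 m))
      + [:0, 1:] * (?p * ?p) + [:1, -1:] * (?q * ?q))"
    by (rule arg_cong)
  then show ?thesis
    unfolding moment_functional_add moment_functional_smult
    using pos[of ?p] le_one[of ?q] by (simp add: moment_functional_pCons moment_functional_def)
qed

section \<open>Self-adjoint operators and matrices\<close>

text \<open>Vectors are functions of which only the indices below \<open>n\<close> matter. Operators
  can then be iterated by \<open>^^\<close> with no carrier conditions.\<close>

definition weighted_dot :: "nat \<Rightarrow> (nat \<Rightarrow> real) \<Rightarrow> (nat \<Rightarrow> real) \<Rightarrow> (nat \<Rightarrow> real) \<Rightarrow> real" where
  "weighted_dot n d f g = (\<Sum>i<n. d i * f i * g i)"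

definition mat_op :: "nat \<Rightarrow> (nat \<Rightarrow> nat \<Rightarrow> real) \<Rightarrow> (nat \<Rightarrow> real) \<Rightarrow> nat \<Rightarrow> real" where
  "mat_op n Z f i = (\<Sum>j<n. Z i j * f j)"

definition weighted_symmetric :: "nat \<Rightarrow> (nat \<Rightarrow> real) \<Rightarrow> (nat \<Rightarrow> nat \<Rightarrow> real) \<Rightarrow> bool" where
  "weighted_symmetric n d Z \<longleftrightarrow> (\<forall>i<n. \<forall>j<n. d i * Z i j = d j * Z j i)"

lemma weighted_dot_self_adjoint:
  assumes "weighted_symmetric n d Z"
  shows "weighted_dot n d (mat_op n Z f) g = weighted_dot n d f (mat_op n Z g)"
proof -
  have "weighted_dot n d (mat_op n Z f) g = (\<Sum>i<n. \<Sum>j<n. (d i * Z i j) * f j * g i)"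
    by (simp add: weighted_dot_def mat_op_def sum_distrib_left sum_distrib_right mult_ac)
  also have "\<dots> = (\<Sum>i<n. \<Sum>j<n. (d j * Z j i) * f j * g i)"
    using assms by (intro sum.cong refl) (auto simp: weighted_symmetric_def)
  also have "\<dots> = weighted_dot n d f (mat_op n Z g)"
    by (subst sum.swap) (simp add: weighted_dot_def mat_op_def sum_distrib_left mult_ac)
  finally show ?thesis .
qed

lemma weighted_dot_funpow:
  assumes "weighted_symmetric n d Z"
  shows "weighted_dot n d ((mat_op n Z ^^ s) f) g = weighted_dot n d f ((mat_op n Z ^^ s) g)"
  by (induction s arbitrary: g)
     (simp_all add: weighted_dot_self_adjoint[OF assms] flip: funpow_swap1)

lemma weighted_dot_Cauchy_Schwarz:
  assumes "\<And>i. i < n \<Longrightarrow> 0 \<le> d i"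
  shows "(weighted_dot n d f g)\<^sup>2 \<le> weighted_dot n d f f * weighted_dot n d g g"
proof -
  have "weighted_dot n d f g = (\<Sum>i<n. (sqrt (d i) * f i) * (sqrt (d i) * g i))"
    unfolding weighted_dot_def
  proof (intro sum.cong refl)
    fix i assume "i \<in> {..<n}"
    then have "sqrt (d i) * sqrt (d i) = d i" using assms by simp
    then show "d i * f i * g i = sqrt (d i) * f i * (sqrt (d i) * g i)"
      by (metis mult.assoc mult.left_commute)
  qed
  moreover have "weighted_dot n d f f = (\<Sum>i<n. (sqrt (d i) * f i)\<^sup>2)" for f
    unfolding weighted_dot_def using assms
    by (intro sum.cong refl) (auto simp: power_mult_distrib power2_eq_square)
  ultimately show ?thesis
    using Cauchy_Schwarz_ineq_sum[of "\<lambda>i. sqrt (d i) * f i" "\<lambda>i. sqrt (d i) * g i" "{..<n}"] by simp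
qed

text \<open>
  The moments \<open>b t = \<langle>f, Z\<^sup>t f\<rangle>\<close> satisfy \<open>b(t)\<^sup>2 \<le> b(0) b(2 t)\<close> by Cauchy-Schwarz, so \<open>b(1) > b(0)\<close> forces
  geometric growth along \<open>t = 2\<^sup>j\<close>. This replaces diagonalisation of the self-adjoint operator.
\<close>

lemma weighted_dot_mat_op_le_if_power_bounded:
  assumes sa: "weighted_symmetric n d Z"
    and d: "\<And>i. i < n \<Longrightarrow> 0 \<le> d i"
    and bounded: "\<And>t i. i < n \<Longrightarrow> \<bar>(mat_op n Z ^^ t) f i\<bar> \<le> B"
  shows "weighted_dot n d f (mat_op n Z f) \<le> weighted_dot n d f f"
proof (rule ccontr)
  define b where "b t = weighted_dot n d f ((mat_op n Z ^^ t) f)" for t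
  assume "\<not> ?thesis"
  then have gt: "b 0 < b 1" by (simp add: b_def)
  have CS: "(b t)\<^sup>2 \<le> b 0 * b (2 * t)" for t
  proof -
    have "(b t)\<^sup>2 \<le> b 0 * weighted_dot n d ((mat_op n Z ^^ t) f) ((mat_op n Z ^^ t) f)"
      unfolding b_def using weighted_dot_Cauchy_Schwarz[OF d] by simp
    also have "weighted_dot n d ((mat_op n Z ^^ t) f) ((mat_op n Z ^^ t) f) = b (2 * t)"
      unfolding weighted_dot_funpow[OF sa] b_def by (simp add: mult_2 funpow_add)
    finally show ?thesis .
  qed
  have "0 \<le> b 0"
    unfolding b_def weighted_dot_def using d by (auto intro!: sum_nonneg simp: mult.assoc)
  \<comment> \<open>If \<open>b 0\<close> vanished, Cauchy-Schwarz at \<open>t = 1\<close> would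
    force \<open>b 1 = 0\<close>, against \<open>gt\<close>.\<close>
  moreover have "b 0 \<noteq> 0" using CS[of 1] gt by auto
  ultimately have pos: "0 < b 0" by simp
  define r where "r = b 1 / b 0"
  have "1 < r" using gt pos by (simp add: r_def)
  have grow: "b 0 * r ^ (2 ^ j) \<le> b (2 ^ j)" for j
  proof (induction j)
    case 0
    show ?case using pos by (simp add: r_def)
  next
    case (Suc j)
    have "b 0 * (b 0 * r ^ (2 ^ Suc j)) = (b 0 * r ^ (2 ^ j))\<^sup>2"
      by (simp add: power_mult_distrib power2_eq_square mult_2 power_add)
    also have "\<dots> \<le> (b (2 ^ j))\<^sup>2"
      using Suc pos \<open>1 < r\<close> by (intro power_mono) auto
    also have "\<dots> \<le> b 0 * b (2 ^ Suc j)" using CS[of "2 ^ j"] by simp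
    finally show ?case using pos by simp
  qed
  define K where "K = (\<Sum>i<n. d i * \<bar>f i\<bar> * B)"
  have "b t \<le> K" for t
    unfolding b_def K_def weighted_dot_def
  proof (intro sum_mono)
    fix i assume i: "i \<in> {..<n}"
    have "d i * f i * (mat_op n Z ^^ t) f i \<le> \<bar>d i * f i * (mat_op n Z ^^ t) f i\<bar>" by simp
    also have "\<dots> = d i * \<bar>f i\<bar> * \<bar>(mat_op n Z ^^ t) f i\<bar>" using d i by (simp add: abs_mult)
    also have "\<dots> \<le> d i * \<bar>f i\<bar> * B" using d i bounded by (intro mult_left_mono) auto
    finally show "d i * f i * (mat_op n Z ^^ t) f i \<le> d i * \<bar>f i\<bar> * B" .
  qed
  moreover obtain t where t: "K / b 0 < r ^ t"
    using real_arch_pow[OF \<open>1 < r\<close>] by blast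
  \<comment> \<open>Growth is known only along powers of two, so the exponent from the Archimedean
    property is enlarged to one.\<close>
  moreover have "r ^ t \<le> r ^ (2 ^ t)"
    using \<open>1 < r\<close> by (intro power_increasing) (auto simp: less_imp_le)
  ultimately show False
    using grow[of t] pos by (smt (verit) mult.commute pos_divide_less_eq)
qed

text \<open>The vector \<open>p(Z) f\<close>, built by components from the moment functional so that
  the algebra of \<open>p\<close> acts directly on the iterates.\<close>

definition poly_op :: "real poly \<Rightarrow> nat \<Rightarrow> (nat \<Rightarrow> nat \<Rightarrow> real) \<Rightarrow> (nat \<Rightarrow> real) \<Rightarrow> nat \<Rightarrow> real" where
  "poly_op p n Z f i = moment_functional (\<lambda>t. (mat_op n Z ^^ t) f i) p"

lemma weighted_dot_moment_functional:
  "weighted_dot n d (\<lambda>i. moment_functional (\<lambda>s. u s i) p) (\<lambda>i. moment_functional (\<lambda>t. v t i) q) =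
    moment_functional (\<lambda>s. moment_functional (\<lambda>t. weighted_dot n d (u s) (v t)) q) p"
  unfolding weighted_dot_def moment_functional_def
  by (simp add: sum_distrib_left sum_distrib_right sum.swap[of _ _ "{..<n}"] mult_ac)

text \<open>Self-adjointness moves all powers of \<open>Z\<close> to one side. The mixed moments
  then depend only on the sum of the exponents, which is the Hankel form that
  \<open>moment_functional_mult\<close> recognises.\<close>

lemma weighted_dot_poly_op:
  assumes "weighted_symmetric n d Z"
  shows "weighted_dot n d (poly_op p n Z g) (poly_op q n Z g) =
    moment_functional (\<lambda>t. weighted_dot n d g ((mat_op n Z ^^ t) g)) (p * q)"
  unfolding poly_op_def[abs_def] weighted_dot_moment_functional moment_functional_mult
    weighted_dot_funpow[OF assms] by (simp add: funpow_add)

lemma mat_op_poly_op: "mat_op n Z (poly_op p n Z g) = poly_op ([:0, 1:] * p) n Z g"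
proof
  fix i
  have "mat_op n Z (poly_op p n Z g) i =
      (\<Sum>t\<le>Polynomial.degree p. Polynomial.coeff p t * mat_op n Z ((mat_op n Z ^^ t) g) i)"
    unfolding mat_op_def[of n Z _ i] poly_op_def moment_functional_def sum_distrib_left
    by (subst sum.swap) (simp add: mult_ac)
  then show "mat_op n Z (poly_op p n Z g) i = poly_op ([:0, 1:] * p) n Z g i"
    by (simp add: poly_op_def moment_functional_pCons) (simp add: moment_functional_def)
qed

text \<open>Nonnegativity of \<open>Z\<close> and the bound by the identity, tested on
  \<open>p(Z) g\<close>, are the two localising conditions for the moments of \<open>g\<close>. The
  polynomial inequality then becomes the operator estimate.\<close>

lemma cheb4_smoothing:
  fixes g :: "nat \<Rightarrow> real" and m :: nat
  assumes sa: "weighted_symmetric n d Z"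
    and pos: "\<And>f. 0 \<le> weighted_dot n d f (mat_op n Z f)"
    and le_one: "\<And>f. weighted_dot n d f (mat_op n Z f) \<le> weighted_dot n d f f"
  defines "w \<equiv> mat_op n Z (poly_op (cheb4 m) n Z g)"
  shows "(2 * real m + 1)\<^sup>2 * weighted_dot n d w w \<le> weighted_dot n d g (mat_op n Z g)"
proof -
  let ?L = "moment_functional (\<lambda>t. weighted_dot n d g ((mat_op n Z ^^ t) g))"
  note dot = weighted_dot_poly_op[OF sa]
  have x: "weighted_dot n d (poly_op p n Z g) (mat_op n Z (poly_op p n Z g)) = ?L ([:0, 1:] * (p * p))" for p
    unfolding mat_op_poly_op dot by (simp add: mult.left_commute del: mult_pCons_left mult_pCons_right)
  have "(2 * real m + 1)\<^sup>2 * ?L (([:0, 1:] * cheb4 m) * ([:0, 1:] * cheb4 m)) \<le>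
      weighted_dot n d g ((mat_op n Z ^^ 1) g)"
  proof (rule moment_functional_cheb4_bound)
    fix p
    show "0 \<le> ?L ([:0, 1:] * (p * p))"
      unfolding x[symmetric] by (rule pos)
    \<comment> \<open>The functional at \<open>(1 - x) p^2\<close> is the difference of the two
      sides of \<open>le_one\<close> for the vector \<open>p(Z) g\<close>.\<close>
    have "p * p = [:1, -1:] * (p * p) + [:0, 1:] * (p * p)"
      by (rule poly_ext) (simp add: algebra_simps)
    then have "?L (p * p) = ?L ([:1, -1:] * (p * p)) + ?L ([:0, 1:] * (p * p))"
      by (metis moment_functional_add)
    then show "0 \<le> ?L ([:1, -1:] * (p * p))"
      using le_one[of "poly_op p n Z g"] unfolding x dot by simp
  qed
  then show ?thesis
    unfolding w_def mat_op_poly_op dot by simp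
qed

section \<open>Matrix powers and the spectral radius\<close>

lemma funpow_mat_op:
  assumes Z: "Z \<in> carrier_mat n n" and F: "\<And>i j. i < n \<Longrightarrow> j < n \<Longrightarrow> F i j = Z $$ (i, j)"
    and i: "i < n"
  shows "(mat_op n F ^^ t) f i = (\<Sum>j<n. (Z ^\<^sub>m t) $$ (i, j) * f j)"
proof (induction t arbitrary: f)
  case 0
  have "(\<Sum>j<n. (1\<^sub>m n :: real mat) $$ (i, j) * f j) = (\<Sum>j<n. if j = i then f j else 0)"
    using i by (intro sum.cong) auto
  then show ?case using Z i by simp
next
  case (Suc t)
  have P: "Z ^\<^sub>m t \<in> carrier_mat n n" using Z by simp
  \<comment> \<open>A matrix power gains its new factor on the right, so the iterate is unfolded
    with the first application innermost.\<close>
  have "(mat_op n F ^^ Suc t) f i = (\<Sum>j<n. (Z ^\<^sub>m t) $$ (i, j) * (\<Sum>l<n. Z $$ (j, l) * f l))"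
    unfolding funpow_Suc_right o_apply Suc by (simp add: mat_op_def F)
  also have "\<dots> = (\<Sum>l<n. (\<Sum>j<n. (Z ^\<^sub>m t) $$ (i, j) * Z $$ (j, l)) * f l)"
    by (simp add: sum_distrib_left sum_distrib_right mult.assoc) (rule sum.swap)
  also have "\<dots> = (\<Sum>l<n. (Z ^\<^sub>m Suc t) $$ (i, l) * f l)"
    using Z i P by (intro sum.cong) (auto simp: scalar_prod_def lessThan_atLeast0)
  finally show ?case .
qed

text \<open>Take an eigenvalue \<open>l\<close> of the scaled matrix that attains its spectral
  radius. Its eigenvector belongs to the eigenvalue \<open>l / c\<close> of \<open>X\<close>.
  Positive dimension guarantees that the spectrum is nonempty.\<close>

lemma spectral_radius_smult_le:
  assumes X: "X \<in> carrier_mat n n" and n: "0 < n" and c: "c \<noteq> 0"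
  shows "spectral_radius (c \<cdot>\<^sub>m X) \<le> cmod c * spectral_radius X"
proof -
  have cX: "c \<cdot>\<^sub>m X \<in> carrier_mat n n" using X by simp
  obtain l where l: "eigenvalue (c \<cdot>\<^sub>m X) l" "spectral_radius (c \<cdot>\<^sub>m X) = cmod l"
    using spectral_radius_mem_max(1)[OF cX n] by (auto simp: spectrum_def)
  then obtain v where v: "v \<in> carrier_vec n" "v \<noteq> 0\<^sub>v n" "(c \<cdot>\<^sub>m X) *\<^sub>v v = l \<cdot>\<^sub>v v"
    using X by (auto simp: eigenvalue_def eigenvector_def)
  have "X *\<^sub>v v = (l / c) \<cdot>\<^sub>v v"
  proof (rule eq_vecI)
    fix i assume "i < dim_vec ((l / c) \<cdot>\<^sub>v v)"
    then have i: "i < n" using v by simp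
    have "c * vec_index (X *\<^sub>v v) i = vec_index ((c \<cdot>\<^sub>m X) *\<^sub>v v) i"
      using i X v(1) by (simp add: scalar_prod_def sum_distrib_left mult.assoc)
    also have "\<dots> = l * vec_index v i" unfolding v(3) using i v(1) by simp
    finally have "c * vec_index (X *\<^sub>v v) i = l * vec_index v i" .
    then show "vec_index (X *\<^sub>v v) i = vec_index ((l / c) \<cdot>\<^sub>v v) i"
      using c i v by (simp add: field_simps)
  qed (use X v in auto)
  then have "eigenvalue X (l / c)"
    using v X by (auto simp: eigenvalue_def eigenvector_def)
  then have "cmod (l / c) \<le> spectral_radius X"
    by (intro spectral_radius_mem_max(2)[OF X n]) (auto simp: spectrum_def)
  then show ?thesis
    using c l(2) by (simp add: norm_divide field_simps)
qed

text \<open>The inequality is strict because at spectral radius one a nontrivial Jordan block would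
  make the powers grow polynomially. The bound is proved over the complex numbers and read back
  entrywise.\<close>

lemma mat_pow_bounded:
  assumes Z: "Z \<in> carrier_mat n n" and "mat_spectral_radius Z < 1"
  shows "\<exists>B. \<forall>t i j. i < n \<longrightarrow> j < n \<longrightarrow> \<bar>(Z ^\<^sub>m t) $$ (i, j)\<bar> \<le> B"
proof -
  let ?Z = "map_mat complex_of_real Z"
  have "?Z \<in> carrier_mat n n" using Z by simp
  then obtain B where B: "\<And>t. norm_bound (?Z ^\<^sub>m t) B"
    using spectral_radius_jnf_norm_bound_less_1_upper_triangular assms(2)
    unfolding mat_spectral_radius_def by blast
  have "\<bar>(Z ^\<^sub>m t) $$ (i, j)\<bar> \<le> B" if "i < n" "j < n" for t i j
  proof -
    have "Z ^\<^sub>m t \<in> carrier_mat n n" using Z by simp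
    moreover have "norm_bound (map_mat complex_of_real (Z ^\<^sub>m t)) B"
      using B[of t] by (simp only: of_real_hom.mat_hom_pow[OF Z])
    ultimately show ?thesis
      using that Z by (auto simp: norm_bound_def)
  qed
  then show ?thesis by blast
qed

text \<open>Shrinking by \<open>\<theta> < 1\<close> brings the spectral radius strictly below one,
  where powers are bounded and the growth argument applies. The inequality is linear in
  \<open>\<theta>\<close> and survives the limit to one.\<close>

lemma weighted_dot_mat_op_le_if_spectral_radius_le_1:
  assumes X: "X \<in> carrier_mat n n" and c: "0 < c" "c * mat_spectral_radius X \<le> 1"
    and sa: "weighted_symmetric n d (\<lambda>i j. X $$ (i, j))"
    and d: "\<And>i. i < n \<Longrightarrow> 0 \<le> d i"
  shows "weighted_dot n d f (mat_op n (\<lambda>i j. c * X $$ (i, j)) f) \<le> weighted_dot n d f f"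
proof (cases "n = 0")
  case True
  then show ?thesis by (simp add: weighted_dot_def)
next
  case False
  let ?T = "mat_op n (\<lambda>i j. c * X $$ (i, j)) f"
  have "\<theta> * weighted_dot n d f ?T \<le> weighted_dot n d f f" if \<theta>: "0 < \<theta>" "\<theta> < 1" for \<theta>
  proof -
    define Z where "Z = (\<theta> * c) \<cdot>\<^sub>m X"
    have Z: "Z \<in> carrier_mat n n" using X by (simp add: Z_def)
    have "map_mat complex_of_real Z = complex_of_real (\<theta> * c) \<cdot>\<^sub>m map_mat complex_of_real X"
      by (auto simp: Z_def)
    then have "mat_spectral_radius Z \<le> cmod (complex_of_real (\<theta> * c)) * mat_spectral_radius X"
      unfolding mat_spectral_radius_def using X False \<theta> c
      by (simp only:) (intro spectral_radius_smult_le[of _ n], auto)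
    also have "\<dots> = \<theta> * (c * mat_spectral_radius X)"
      using \<theta> c by (simp add: norm_mult)
    also have "\<dots> \<le> \<theta> * 1" using \<theta> c by (intro mult_left_mono) auto
    also have "\<dots> < 1" using \<theta> by simp
    finally obtain B where B: "\<And>t i j. i < n \<Longrightarrow> j < n \<Longrightarrow> \<bar>(Z ^\<^sub>m t) $$ (i, j)\<bar> \<le> B"
      using mat_pow_bounded[OF Z] by blast
    have "weighted_dot n d f (mat_op n (\<lambda>i j. Z $$ (i, j)) f) \<le> weighted_dot n d f f"
    proof (rule weighted_dot_mat_op_le_if_power_bounded[OF _ d])
      show "weighted_symmetric n d (\<lambda>i j. Z $$ (i, j))"
        using sa X by (auto simp: Z_def weighted_symmetric_def)
      show "\<bar>(mat_op n (\<lambda>i j. Z $$ (i, j)) ^^ t) f i\<bar> \<le> (\<Sum>j<n. B * \<bar>f j\<bar>)" if "i < n" for t i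
      proof -
        have "\<bar>(mat_op n (\<lambda>i j. Z $$ (i, j)) ^^ t) f i\<bar> \<le> (\<Sum>j<n. \<bar>(Z ^\<^sub>m t) $$ (i, j) * f j\<bar>)"
          unfolding funpow_mat_op[OF Z refl that] by (rule sum_abs)
        also have "\<dots> \<le> (\<Sum>j<n. B * \<bar>f j\<bar>)"
          unfolding abs_mult using B that by (intro sum_mono mult_right_mono) auto
        finally show ?thesis .
      qed
    qed
    moreover have "weighted_dot n d f (mat_op n (\<lambda>i j. Z $$ (i, j)) f) = \<theta> * weighted_dot n d f ?T"
      using X unfolding weighted_dot_def mat_op_def
      by (simp add: Z_def sum_distrib_left mult_ac)
    ultimately show ?thesis by simp
  qed
  note le = this
  show ?thesis
  proof (rule tendsto_le)
    show "((\<lambda>\<theta>. \<theta> * weighted_dot n d f ?T) \<longlongrightarrow> weighted_dot n d f ?T) (at_left 1)"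
      by (auto intro!: tendsto_eq_intros)
    show "\<forall>\<^sub>F \<theta> in at_left 1. \<theta> * weighted_dot n d f ?T \<le> weighted_dot n d f f"
      using eventually_at_left_real[of 0 1] by (rule eventually_mono) (auto intro: le)
  qed auto
qed

section \<open>The smoothing estimate for matrices\<close>

lemma scalar_prod_eq_sum:
  "v \<in> carrier_vec n \<Longrightarrow> scalar_prod u v = (\<Sum>i<n. vec_index u i * vec_index v i)"
  by (simp add: scalar_prod_def lessThan_atLeast0)

lemma index_mult_mat_vec_sum:
  assumes "A \<in> carrier_mat n n" "v \<in> carrier_vec n" "i < n"
  shows "vec_index (A *\<^sub>v v) i = (\<Sum>j<n. A $$ (i, j) * vec_index v j)"
  using assms by (simp add: scalar_prod_eq_sum[OF assms(2)])

lemma energy_norm_0_square: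
  assumes "A \<in> carrier_mat n n" "v \<in> carrier_vec n"
  shows "(energy_norm A 0 v)\<^sup>2 = (\<Sum>i<n. (vec_index v i)\<^sup>2)"
proof -
  have "1\<^sub>m n *\<^sub>v v = v" using assms by simp
  then show ?thesis
    using assms by (simp add: energy_norm_def scalar_prod_eq_sum[OF assms(2)] sum_nonneg
        flip: power2_eq_square)
qed

lemma energy_norm_1:
  assumes "A \<in> carrier_mat n n" "v \<in> carrier_vec n"
  shows "energy_norm A 1 v = sqrt (\<Sum>i<n. \<Sum>j<n. vec_index v i * vec_index v j * A $$ (i, j))"
  using assms by (simp add: energy_norm_def scalar_prod_eq_sum[of _ n] sum_distrib_left mult_ac)

text \<open>Since \<open>D Z = \<omega> A\<close>, the vector \<open>A P g\<close> is
  \<open>D w / \<omega>\<close> with \<open>w = Z P g\<close>. Its squared norm weighted by the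
  inverse of \<open>M\<close> is at most \<open>K / \<omega>^2\<close> times the
  \<open>D\<close>-norm of \<open>w\<close> squared, and \<open>cheb4_smoothing\<close> gives back
  one factor \<open>\<omega>\<close>.\<close>

lemma cheb4_matrix_smoothing:
  assumes A: "A \<in> carrier_mat n n" and M: "M \<in> carrier_mat n n"
    and sym: "\<And>i j. i < n \<Longrightarrow> j < n \<Longrightarrow> A $$ (i, j) = A $$ (j, i)"
    and psd: "\<And>f. 0 \<le> (\<Sum>i<n. \<Sum>j<n. f i * f j * A $$ (i, j))"
    and dpos: "\<And>i. i < n \<Longrightarrow> 0 < A $$ (i, i)"
    and mpos: "\<And>i. i < n \<Longrightarrow> 0 < M $$ (i, i)"
    and dm: "\<And>i. i < n \<Longrightarrow> A $$ (i, i) \<le> K * M $$ (i, i)"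
    and X: "X = diag_powr (diag_part A) (- 1) * A"
    and \<omega>: "0 < \<omega>" "\<omega> * mat_spectral_radius X \<le> 1"
    and g: "g \<in> carrier_vec n"
  shows "(energy_norm A 0 ((diag_powr M (- 1/2) * A * poly_mat (cheb4 m) (\<omega> \<cdot>\<^sub>m X)) *\<^sub>v g))\<^sup>2
    \<le> K / (\<omega> * (2 * real m + 1)\<^sup>2) * (energy_norm A 1 g)\<^sup>2"
proof -
  define d where "d i = A $$ (i, i)" for i
  have d: "0 < d i" if "i < n" for i using dpos[OF that] by (simp add: d_def)
  define Z where "Z = (\<lambda>i j. \<omega> * X $$ (i, j))"
  have D: "diag_powr (diag_part A) (- 1) \<in> carrier_mat n n"
    using A by (simp add: diag_powr_def diag_part_def mat_diag_def)
  have Xc: "X \<in> carrier_mat n n" using A D unfolding X by simp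
  have Xij: "X $$ (i, j) = A $$ (i, j) / d i" if "i < n" "j < n" for i j
  proof -
    have "diag_powr (diag_part A) (- 1) = mat_diag n (\<lambda>i. inverse (d i))"
      using A d by (auto simp: diag_powr_def diag_part_def d_def powr_minus mat_diag_def less_imp_le)
    then show ?thesis
      unfolding X using that A by (simp add: mat_diag_mult_left[OF A] field_simps)
  qed
  have dX: "d i * X $$ (i, j) = A $$ (i, j)" if "i < n" "j < n" for i j
    using Xij[OF that] d[OF that(1)] by simp
  have saX: "weighted_symmetric n d (\<lambda>i j. X $$ (i, j))"
    using dX sym by (simp add: weighted_symmetric_def)
  then have sa: "weighted_symmetric n d Z"
    by (simp add: Z_def weighted_symmetric_def mult.left_commute)
  have dT: "d i * mat_op n Z f i = \<omega> * (\<Sum>j<n. A $$ (i, j) * f j)" if "i < n" for f i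
    unfolding mat_op_def Z_def sum_distrib_left
    using that by (intro sum.cong refl) (simp add: dX[symmetric])
  have energy: "weighted_dot n d f (mat_op n Z f) = \<omega> * (\<Sum>i<n. \<Sum>j<n. f i * f j * A $$ (i, j))" for f
  proof -
    have "weighted_dot n d f (mat_op n Z f) = (\<Sum>i<n. f i * (d i * mat_op n Z f i))"
      by (simp add: weighted_dot_def mult_ac)
    also have "\<dots> = (\<Sum>i<n. f i * (\<omega> * (\<Sum>j<n. A $$ (i, j) * f j)))"
      by (intro sum.cong refl) (simp add: dT)
    finally show ?thesis by (simp add: sum_distrib_left mult_ac)
  qed
  define gf where "gf = vec_index g"
  define u where "u = poly_op (cheb4 m) n Z gf"
  define w where "w = mat_op n Z u"
  have main: "(2 * real m + 1)\<^sup>2 * weighted_dot n d w w \<le> weighted_dot n d gf (mat_op n Z gf)"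
    unfolding w_def u_def
  proof (rule cheb4_smoothing[OF sa])
    show "0 \<le> weighted_dot n d f (mat_op n Z f)" for f
      unfolding energy using psd \<omega> by simp
    show "weighted_dot n d f (mat_op n Z f) \<le> weighted_dot n d f f" for f
      unfolding Z_def
      by (rule weighted_dot_mat_op_le_if_spectral_radius_le_1[OF Xc \<omega> saX]) (auto intro: less_imp_le d)
  qed
  have cZ: "\<omega> \<cdot>\<^sub>m X \<in> carrier_mat n n" using Xc by simp
  define P where "P = poly_mat (cheb4 m) (\<omega> \<cdot>\<^sub>m X)"
  have P: "P \<in> carrier_mat n n" using Xc by (simp add: P_def poly_mat_def)
  have powZ: "(mat_op n Z ^^ t) f i = (\<Sum>j<n. ((\<omega> \<cdot>\<^sub>m X) ^\<^sub>m t) $$ (i, j) * f j)" if "i < n" for t f i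
    by (rule funpow_mat_op[OF cZ _ that]) (use Xc in \<open>simp add: Z_def\<close>)
  have Pg: "vec_index (P *\<^sub>v g) i = u i" if "i < n" for i
  proof -
    have "vec_index (P *\<^sub>v g) i = (\<Sum>j<n. P $$ (i, j) * gf j)"
      using index_mult_mat_vec_sum[OF P g that] by (simp only: gf_def)
    also have "\<dots> = (\<Sum>j<n. (\<Sum>t\<le>Polynomial.degree (cheb4 m). Polynomial.coeff (cheb4 m) t * ((\<omega> \<cdot>\<^sub>m X) ^\<^sub>m t) $$ (i, j)) * gf j)"
      using that Xc by (intro sum.cong) (auto simp: P_def poly_mat_def)
    also have "\<dots> = u i"
      unfolding u_def poly_op_def moment_functional_def powZ[OF that] sum_distrib_left sum_distrib_right
      by (subst sum.swap) (simp add: mult.assoc)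
    finally show ?thesis .
  qed
  have Pgc: "P *\<^sub>v g \<in> carrier_vec n" using P g by simp
  define H where "H = diag_powr M (- 1/2)"
  have H: "H \<in> carrier_mat n n" using M by (simp add: H_def diag_powr_def)
  define v where "v = (H * A * P) *\<^sub>v g"
  have vi: "vec_index v i = (M $$ (i, i)) powr (- 1/2) * (d i / \<omega> * w i)" if "i < n" for i
  proof -
    have "v = H *\<^sub>v (A *\<^sub>v (P *\<^sub>v g))"
      unfolding v_def using H A P g assoc_mult_mat_vec[of "H * A" n n P n g] assoc_mult_mat_vec[of H n n A n "P *\<^sub>v g"]
      by simp
    then have "vec_index v i = (\<Sum>j<n. H $$ (i, j) * vec_index (A *\<^sub>v (P *\<^sub>v g)) j)"
      using index_mult_mat_vec_sum[OF H _ that] A Pgc by (simp only: mult_mat_vec_carrier)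
    also have "\<dots> = (\<Sum>j<n. if j = i then (M $$ (i, i)) powr (- 1/2) * vec_index (A *\<^sub>v (P *\<^sub>v g)) i else 0)"
      using that M by (intro sum.cong) (auto simp: H_def diag_powr_def mat_diag_def)
    also have "\<dots> = (M $$ (i, i)) powr (- 1/2) * vec_index (A *\<^sub>v (P *\<^sub>v g)) i"
      using that by simp
    also have "vec_index (A *\<^sub>v (P *\<^sub>v g)) i = (\<Sum>j<n. A $$ (i, j) * u j)"
      unfolding index_mult_mat_vec_sum[OF A Pgc that] by (simp add: Pg del: index_mult_mat_vec)
    also have "\<dots> = d i / \<omega> * w i"
      using dT[OF that, of u] \<omega> by (simp add: w_def field_simps)
    finally show ?thesis .
  qed
  have vc: "v \<in> carrier_vec n" unfolding v_def using H A P g by (meson mult_carrier_mat mult_mat_vec_carrier)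
  have "(energy_norm A 0 v)\<^sup>2 = (\<Sum>i<n. (vec_index v i)\<^sup>2)"
    by (rule energy_norm_0_square[OF A vc])
  also have "\<dots> \<le> (\<Sum>i<n. K / \<omega>\<^sup>2 * (d i * w i * w i))"
  proof (intro sum_mono)
    fix i assume "i \<in> {..<n}"
    then have i: "i < n" by simp
    have sq: "((M $$ (i, i)) powr (- 1/2))\<^sup>2 = 1 / M $$ (i, i)"
    proof -
      have "((M $$ (i, i)) powr (- 1/2))\<^sup>2 = (M $$ (i, i)) powr (- 1/2 + - 1/2)"
        by (simp only: power2_eq_square powr_add)
      also have "- 1/2 + - 1/2 = (- 1 :: real)" by simp
      finally show ?thesis using mpos[OF i] by (simp only: powr_neg_one)
    qed
    have "(vec_index v i)\<^sup>2 = d i / M $$ (i, i) * (d i * (w i)\<^sup>2 / \<omega>\<^sup>2)"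
      unfolding vi[OF i] power_mult_distrib sq by (simp add: power_divide power2_eq_square)
    also have "d i / M $$ (i, i) * (d i * (w i)\<^sup>2 / \<omega>\<^sup>2) \<le> K * (d i * (w i)\<^sup>2 / \<omega>\<^sup>2)"
    proof (rule mult_right_mono)
      show "d i / M $$ (i, i) \<le> K"
        using dm[OF i] mpos[OF i] by (simp add: d_def pos_divide_le_eq)
      show "0 \<le> d i * (w i)\<^sup>2 / \<omega>\<^sup>2"
        using d[OF i] by simp
    qed
    finally show "(vec_index v i)\<^sup>2 \<le> K / \<omega>\<^sup>2 * (d i * w i * w i)"
      by (simp add: power2_eq_square mult_ac)
  qed
  also have "\<dots> = K / \<omega>\<^sup>2 * weighted_dot n d w w"
    by (simp add: weighted_dot_def sum_distrib_left)
  finally have 1: "(energy_norm A 0 v)\<^sup>2 \<le> K / \<omega>\<^sup>2 * weighted_dot n d w w" .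
  \<comment> \<open>The sign of \<open>K\<close> comes from \<open>dpos\<close>, \<open>dm\<close>
    and \<open>mpos\<close> at index 0. If there is no index, both sides of the estimate below
    vanish.\<close>
  have "0 \<le> K / \<omega>\<^sup>2 \<or> n = 0"
  proof (cases "n = 0")
    case False
    then have "0 < K * M $$ (0, 0)" using dpos[of 0] dm[of 0] by simp
    then show ?thesis using mpos[of 0] False by (simp add: zero_less_mult_iff)
  qed simp
  moreover have 2: "weighted_dot n d w w \<le> \<omega> * (energy_norm A 1 g)\<^sup>2 / (2 * real m + 1)\<^sup>2"
  proof -
    have "(energy_norm A 1 g)\<^sup>2 = (\<Sum>i<n. \<Sum>j<n. gf i * gf j * A $$ (i, j))"
      unfolding energy_norm_1[OF A g] gf_def using psd by simp
    then have "weighted_dot n d gf (mat_op n Z gf) = \<omega> * (energy_norm A 1 g)\<^sup>2"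
      unfolding energy by simp
    moreover have "0 < (2 * real m + 1)\<^sup>2" by (simp add: add_nonneg_pos)
    ultimately show ?thesis using main by (simp add: field_simps)
  qed
  ultimately have "K / \<omega>\<^sup>2 * weighted_dot n d w w \<le> K / \<omega>\<^sup>2 * (\<omega> * (energy_norm A 1 g)\<^sup>2 / (2 * real m + 1)\<^sup>2)"
  proof (elim disjE)
    assume "n = 0"
    then show ?thesis
      using g by (simp add: weighted_dot_def energy_norm_def scalar_prod_def)
  qed (rule mult_left_mono[OF 2])
  also have "\<dots> = K / (\<omega> * (2 * real m + 1)\<^sup>2) * (energy_norm A 1 g)\<^sup>2"
    using \<omega> by (simp add: power2_eq_square)
  finally show ?thesis
    using 1 by (simp add: v_def H_def P_def)
qed

section \<open>Integrals over cells and faces\<close>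

text \<open>Fubini for tensor products. Lebesgue measure on vectors is the image of a product
  measure indexed by \<open>Basis\<close>, so coordinates are renamed along the bijection
  \<open>i\<close> to \<open>axis i 1\<close>.\<close>

lemma lborel_integral_vec_prod:
  fixes f :: "'n::finite \<Rightarrow> real \<Rightarrow> real"
  assumes f: "\<And>i. integrable lborel (f i)"
  shows "(\<integral>x. (\<Prod>i\<in>UNIV. f i (x $ i)) \<partial>(lborel :: (real ^ 'n) measure)) = (\<Prod>i\<in>UNIV. \<integral>t. f i t \<partial>lborel)"
proof -
  interpret product_sigma_finite "\<lambda>_::real ^ 'n. lborel :: real measure" ..
  let ?e = "\<lambda>i::'n. axis i (1::real)"
  have bij: "bij_betw ?e UNIV Basis"
    by (auto simp: bij_betw_def inj_on_def axis_eq_axis Basis_vec_def)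
  define g where "g b = f (the_inv_into UNIV ?e b)" for b
  have g: "g (?e i) = f i" for i
    unfolding g_def using bij by (subst the_inv_into_f_f) (auto simp: bij_betw_def)
  have nth: "(\<Sum>b\<in>Basis. y b *\<^sub>R b) $ i = y (?e i)" for y :: "real ^ 'n \<Rightarrow> real" and i
  proof -
    have "(\<Sum>b\<in>Basis. y b *\<^sub>R b) $ i = (\<Sum>b\<in>Basis. y b *\<^sub>R b) \<bullet> ?e i"
      by (simp add: inner_axis)
    also have "\<dots> = y (?e i)"
      by (rule inner_sum_left_Basis) (simp add: axis_in_Basis_iff)
    finally show ?thesis .
  qed
  have [measurable]: "f i \<in> borel_measurable borel" for i
    using borel_measurable_integrable[OF f[of i]] by simp
  have "(\<integral>x. (\<Prod>i\<in>UNIV. f i (x $ i)) \<partial>(lborel :: (real ^ 'n) measure))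
      = (\<integral>y. (\<Prod>i\<in>UNIV. f i ((\<Sum>b\<in>Basis. y b *\<^sub>R b) $ i)) \<partial>(\<Pi>\<^sub>M b\<in>(Basis :: (real ^ 'n) set). lborel))"
    by (subst lborel_eq, subst integral_distr) (auto simp: cart_eq_inner_axis)
  also have "\<dots> = (\<integral>y. (\<Prod>b\<in>Basis. g b (y b)) \<partial>(\<Pi>\<^sub>M b\<in>(Basis :: (real ^ 'n) set). lborel))"
    unfolding nth by (simp add: g flip: prod.reindex_bij_betw[OF bij])
  also have "\<dots> = (\<Prod>b\<in>Basis. \<integral>t. g b t \<partial>lborel)"
    by (rule product_integral_prod) (auto simp: g_def f)
  also have "\<dots> = (\<Prod>i\<in>UNIV. \<integral>t. f i t \<partial>lborel)"
    by (simp add: g flip: prod.reindex_bij_betw[OF bij])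
  finally show ?thesis .
qed

lemma prod_indicator_mult:
  fixes f :: "'i \<Rightarrow> real \<Rightarrow> real"
  assumes "finite I"
  shows "(\<Prod>i\<in>I. indicator (S i) (x i) * f i (x i)) =
     (if \<forall>i\<in>I. x i \<in> S i then \<Prod>i\<in>I. f i (x i) else 0)"
proof (cases "\<forall>i\<in>I. x i \<in> S i")
  case True
  then show ?thesis by (auto intro: prod.cong)
next
  case False
  then obtain i where "i \<in> I" "indicator (S i) (x i) * f i (x i) = 0" by auto
  then show ?thesis using assms False by (auto intro: prod_zero)
qed

lemma cell_integral_prod:
  fixes f :: "'n::finite \<Rightarrow> real \<Rightarrow> real"
  assumes "\<And>i. set_integrable lborel {a $ i + real (z i) * h .. a $ i + (real (z i) + 1) * h} (f i)"
  shows "cell_integral a h z (\<lambda>x. \<Prod>i\<in>UNIV. f i (x $ i)) =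
    (\<Prod>i\<in>UNIV. LINT t:{a $ i + real (z i) * h .. a $ i + (real (z i) + 1) * h}|lborel. f i t)"
proof -
  let ?S = "\<lambda>i. {a $ i + real (z i) * h .. a $ i + (real (z i) + 1) * h}"
  have eq: "indicator (cell a h z) x *\<^sub>R (\<Prod>i\<in>UNIV. f i (x $ i)) =
      (\<Prod>i\<in>UNIV. indicator (?S i) (x $ i) * f i (x $ i))" for x :: "real ^ 'n"
    by (subst prod_indicator_mult) (auto simp: cell_def mem_box_cart indicator_def)
  show ?thesis
    using assms unfolding cell_integral_def set_lebesgue_integral_def set_integrable_def eq
    by (subst lborel_integral_vec_prod) auto
qed

lemma face_integral_prod:
  fixes f :: "'n::finite \<Rightarrow> real \<Rightarrow> real"
  assumes f: "\<And>j. set_integrable lborel {a $ j + real (z j) * h .. a $ j + (real (z j) + 1) * h} (f j)"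
  shows "face_integral a h (i, z) (\<lambda>x. \<Prod>j\<in>UNIV. f j (x $ j)) =
    f i (a $ i + real (z i) * h) *
    (\<Prod>j\<in>UNIV - {i}. LINT t:{a $ j + real (z j) * h .. a $ j + (real (z j) + 1) * h}|lborel. f j t)"
proof -
  interpret product_sigma_finite "\<lambda>_::'n. lborel :: real measure" ..
  let ?S = "\<lambda>j. {a $ j + real (z j) * h .. a $ j + (real (z j) + 1) * h}"
  let ?P = "\<Pi>\<^sub>M j\<in>UNIV - {i}. (lborel :: real measure)"
  let ?x = "\<lambda>y. \<chi> j. if j = i then a $ i + real (z i) * h else y j"
  have split: "(\<Prod>j\<in>UNIV. f j (?x y $ j)) = f i (a $ i + real (z i) * h) * (\<Prod>j\<in>UNIV - {i}. f j (y j))" for y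
    by (subst prod.remove[of _ i]) (auto intro!: prod.cong)
  have "face_integral a h (i, z) (\<lambda>x. \<Prod>j\<in>UNIV. f j (x $ j)) =
      (\<integral>y. f i (a $ i + real (z i) * h) * (\<Prod>j\<in>UNIV - {i}. indicator (?S j) (y j) * f j (y j)) \<partial>?P)"
    unfolding face_integral_def set_lebesgue_integral_def prod.case split
    by (intro Bochner_Integration.integral_cong refl, subst prod_indicator_mult)
       (auto simp: space_PiM PiE_iff indicator_def)
  also have "\<dots> = f i (a $ i + real (z i) * h) *
      (\<Prod>j\<in>UNIV - {i}. \<integral>t. indicator (?S j) t * f j t \<partial>lborel)"
    using f by (subst integral_mult_right_zero, subst product_integral_prod)
      (auto simp: set_integrable_def)
  finally show ?thesis
    by (simp add: set_lebesgue_integral_def)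
qed

lemma set_integral_poly_affine:
  assumes "0 < h"
  shows "(LINT t:{\<alpha>..\<alpha> + h}|lborel. poly p (2 * (t - \<alpha>) / h - 1)) = h / 2 * unit_integral p"
proof -
  have "(LINT t:{\<alpha>..\<alpha> + h}|lborel. poly p (2 * (t - \<alpha>) / h - 1)) =
     \<bar>h / 2\<bar> * (\<integral>x. indicator {\<alpha>..\<alpha> + h} (\<alpha> + h / 2 + h / 2 * x) *
        poly p (2 * (\<alpha> + h / 2 + h / 2 * x - \<alpha>) / h - 1) \<partial>lborel)"
    unfolding set_lebesgue_integral_def
    using assms by (subst lborel_integral_real_affine[where c = "h / 2" and t = "\<alpha> + h / 2"]) auto
  also have "(\<integral>x. indicator {\<alpha>..\<alpha> + h} (\<alpha> + h / 2 + h / 2 * x) *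
        poly p (2 * (\<alpha> + h / 2 + h / 2 * x - \<alpha>) / h - 1) \<partial>lborel) = unit_integral p"
    unfolding unit_integral_def set_lebesgue_integral_def
  proof (intro Bochner_Integration.integral_cong refl)
    fix x :: real
    have 1: "2 * (\<alpha> + h / 2 + h / 2 * x - \<alpha>) / h - 1 = x"
      using assms by (simp add: field_simps)
    have "\<alpha> + h / 2 + h / 2 * x = \<alpha> + h / 2 * (1 + x)" by (simp add: algebra_simps)
    then have 2: "\<alpha> \<le> \<alpha> + h / 2 + h / 2 * x \<longleftrightarrow> -1 \<le> x"
      using assms zero_le_mult_iff[of "h / 2" "1 + x"] by (simp only: le_add_same_cancel1) auto
    have "\<alpha> + h / 2 + h / 2 * x = \<alpha> + h - h / 2 * (1 - x)" by (simp add: field_simps)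
    then have 3: "\<alpha> + h / 2 + h / 2 * x \<le> \<alpha> + h \<longleftrightarrow> x \<le> 1"
      using assms zero_le_mult_iff[of "h / 2" "1 - x"] by (simp only: diff_le_eq le_add_same_cancel1) auto
    show "indicator {\<alpha>..\<alpha> + h} (\<alpha> + h / 2 + h / 2 * x) * poly p (2 * (\<alpha> + h / 2 + h / 2 * x - \<alpha>) / h - 1) =
        indicator {- 1..1} x *\<^sub>R poly p x"
      unfolding 1 using 2 3 by (simp add: indicator_def)
  qed
  finally show ?thesis using assms by simp
qed

section \<open>Integrability and linearity of cell and face integrals\<close>

lemma set_integrable_cell:
  fixes f :: "real ^ 'n::finite \<Rightarrow> real"
  assumes "continuous_on UNIV f"
  shows "set_integrable lborel (cell a h z) f"
  unfolding cell_def set_integrable_def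
  by (rule borel_integrable_compact) (use assms continuous_on_subset in auto)

text \<open>The face is a compact box that is degenerate in direction \<open>i\<close>, so a
  continuous integrand is bounded on it. The parameter domain has finite product measure.\<close>

lemma set_integrable_face:
  fixes f :: "real ^ 'n::finite \<Rightarrow> real"
  assumes f: "continuous_on UNIV f"
  shows "set_integrable (PiM (UNIV - {i}) (\<lambda>_. lborel))
       (PiE (UNIV - {i}) (\<lambda>j. {a $ j + real (z j) * h .. a $ j + (real (z j) + 1) * h}))
       (\<lambda>y. f (\<chi> j. if j = i then c else y j))"
proof -
  interpret product_sigma_finite "\<lambda>_::'n. lborel :: real measure" ..
  let ?P = "\<Pi>\<^sub>M j\<in>UNIV - {i}. (lborel :: real measure)"
  let ?l = "\<lambda>j. a $ j + real (z j) * h" and ?r = "\<lambda>j. a $ j + (real (z j) + 1) * h"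
  let ?S = "PiE (UNIV - {i}) (\<lambda>j. {?l j .. ?r j})"
  let ?x = "\<lambda>y. \<chi> j. if j = i then c else y j"
  let ?K = "cbox (\<chi> j. if j = i then c else ?l j) (\<chi> j. if j = i then c else ?r j)"
  have "compact (f ` ?K)"
    by (intro compact_continuous_image continuous_on_subset[OF f]) auto
  then obtain B where B: "\<And>x. x \<in> ?K \<Longrightarrow> norm (f x) \<le> B"
    using compact_imp_bounded[of "f ` ?K"] unfolding bounded_iff by blast
  have [measurable]: "?x \<in> borel_measurable ?P"
  proof (subst borel_measurable_euclidean_space, intro ballI)
    fix b :: "real ^ 'n" assume "b \<in> Basis"
    then obtain j where b: "b = axis j 1" by (auto simp: Basis_vec_def)
    show "(\<lambda>y. ?x y \<bullet> b) \<in> borel_measurable ?P"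
      unfolding b inner_axis by (cases "j = i") auto
  qed
  have [measurable]: "f \<in> borel_measurable borel"
    using f by (rule borel_measurable_continuous_onI)
  have S: "?S \<in> sets ?P" by (intro sets_PiM_I_finite) auto
  have "emeasure ?P ?S = (\<Prod>j\<in>UNIV - {i}. emeasure lborel {?l j .. ?r j})"
    by (intro emeasure_PiM) auto
  also have "\<dots> < \<infinity>"
    by (simp add: ennreal_prod_eq_top less_top[symmetric] emeasure_lborel_Icc_eq)
  finally have fin: "emeasure ?P ?S < \<infinity>" .
  show ?thesis
    unfolding set_integrable_def
  proof (rule integrableI_bounded_set_indicator[OF S _ fin])
    show "(\<lambda>y. f (?x y)) \<in> borel_measurable ?P" by measurable
    show "AE y in ?P. y \<in> ?S \<longrightarrow> norm (f (?x y)) \<le> B"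
      by (intro AE_I2 impI B) (auto simp: mem_box_cart PiE_iff)
  qed
qed

lemma cell_integral_sum:
  fixes f :: "'s \<Rightarrow> real ^ 'n::finite \<Rightarrow> real"
  assumes "\<And>s. s \<in> S \<Longrightarrow> continuous_on UNIV (f s)"
  shows "cell_integral a h z (\<lambda>x. \<Sum>s\<in>S. c s * f s x) = (\<Sum>s\<in>S. c s * cell_integral a h z (f s))"
proof -
  have "integrable lborel (\<lambda>x. indicator (cell a h z) x *\<^sub>R f s x)" if "s \<in> S" for s
    using set_integrable_cell[OF assms[OF that]] by (simp add: set_integrable_def)
  then have "(\<integral>x. (\<Sum>s\<in>S. c s * (indicator (cell a h z) x *\<^sub>R f s x)) \<partial>lborel) =
      (\<Sum>s\<in>S. c s * (\<integral>x. indicator (cell a h z) x *\<^sub>R f s x \<partial>lborel))"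
    by (subst Bochner_Integration.integral_sum) auto
  moreover have "(\<Sum>s\<in>S. c s * (indicator (cell a h z) x *\<^sub>R f s x)) =
      indicator (cell a h z) x *\<^sub>R (\<Sum>s\<in>S. c s * f s x)" for x
    by (simp add: sum_distrib_left mult.left_commute)
  ultimately show ?thesis
    by (simp only: cell_integral_def set_lebesgue_integral_def)
qed

lemma face_integral_sum:
  fixes f :: "'s \<Rightarrow> real ^ 'n::finite \<Rightarrow> real"
  assumes "\<And>s. s \<in> S \<Longrightarrow> continuous_on UNIV (f s)"
  shows "face_integral a h F (\<lambda>x. \<Sum>s\<in>S. c s * f s x) = (\<Sum>s\<in>S. c s * face_integral a h F (f s))"
proof -
  obtain i z where F: "F = (i, z)" by (cases F)
  let ?P = "\<Pi>\<^sub>M j\<in>UNIV - {i}. (lborel :: real measure)"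
  let ?S = "PiE (UNIV - {i}) (\<lambda>j. {a $ j + real (z j) * h .. a $ j + (real (z j) + 1) * h})"
  let ?x = "\<lambda>y. \<chi> j. if j = i then a $ i + real (z i) * h else y j"
  have "integrable ?P (\<lambda>y. indicator ?S y *\<^sub>R f s (?x y))" if "s \<in> S" for s
    using set_integrable_face[OF assms[OF that]] by (simp add: set_integrable_def)
  then have "(\<integral>y. (\<Sum>s\<in>S. c s * (indicator ?S y *\<^sub>R f s (?x y))) \<partial>?P) =
      (\<Sum>s\<in>S. c s * (\<integral>y. indicator ?S y *\<^sub>R f s (?x y) \<partial>?P))"
    by (subst Bochner_Integration.integral_sum) auto
  moreover have "(\<Sum>s\<in>S. c s * (indicator ?S y *\<^sub>R f s (?x y))) =
      indicator ?S y *\<^sub>R (\<Sum>s\<in>S. c s * f s (?x y))" for y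
    by (simp add: sum_distrib_left mult.left_commute)
  ultimately show ?thesis
    by (simp only: F face_integral_def set_lebesgue_integral_def prod.case)
qed

section \<open>The bilinear form on the basis\<close>

lemma dg_basis_has_derivative:
  "(dg_basis a h s (fst s) has_derivative
     (\<lambda>v. \<Sum>i\<in>UNIV. poly (pderiv (legendre (snd s i))) (cell_map_inv a h (fst s) x $ i) * (2 / h * v $ i) *
        (\<Prod>j\<in>UNIV - {i}. poly (legendre (snd s j)) (cell_map_inv a h (fst s) x $ j)))) (at x)"
proof -
  have *: "((\<lambda>x. poly p (cell_map_inv a h (fst s) x $ i)) has_derivative
      (\<lambda>v. poly (pderiv p) (cell_map_inv a h (fst s) x $ i) * (2 / h * v $ i))) (at x)" for p i
  proof -
    have "((\<lambda>x. cell_map_inv a h (fst s) x $ i) has_derivative (\<lambda>v. 2 / h * v $ i)) (at x)"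
    proof -
      have "(\<lambda>x. cell_map_inv a h (fst s) x $ i) =
          (\<lambda>x. 2 / h * (x $ i - (a $ i + real (fst s i) * h)) - 1)"
        by (simp add: cell_map_inv_def)
      then show ?thesis
        by (auto intro!: derivative_eq_intros bounded_linear.has_derivative[OF bounded_linear_vec_nth]
            simp del: times_divide_eq_left)
    qed
    from has_derivative_compose[OF this poly_DERIV[of p, unfolded has_field_derivative_def]]
    show ?thesis .
  qed
  have eq: "dg_basis a h s (fst s) =
      (\<lambda>x. \<Prod>i\<in>UNIV. poly (legendre (snd s i)) (cell_map_inv a h (fst s) x $ i))"
    by (simp add: dg_basis_def)
  show ?thesis
    unfolding eq by (rule has_derivative_prod) (rule *)
qed

lemma dg_basis_other: "z \<noteq> fst s \<Longrightarrow> dg_basis a h s z = (\<lambda>_. 0)"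
  by (auto simp: dg_basis_def)

lemma dg_basis_differentiable: "dg_basis a h s z differentiable (at x)"
  using dg_basis_has_derivative[of a h s x] by (cases "z = fst s") (auto simp: dg_basis_other differentiable_def)

lemma grad_dg_basis:
  "grad (dg_basis a h s z) x = (\<chi> i. if z = fst s
     then 2 / h * poly (pderiv (legendre (snd s i))) (cell_map_inv a h z x $ i) *
       (\<Prod>j\<in>UNIV - {i}. poly (legendre (snd s j)) (cell_map_inv a h z x $ j))
     else 0)"
proof (cases "z = fst s")
  case True
  have "frechet_derivative (dg_basis a h s z) (at x) =
     (\<lambda>v. \<Sum>i\<in>UNIV. poly (pderiv (legendre (snd s i))) (cell_map_inv a h z x $ i) * (2 / h * v $ i) *
        (\<Prod>j\<in>UNIV - {i}. poly (legendre (snd s j)) (cell_map_inv a h z x $ j)))"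
    unfolding True by (rule frechet_derivative_at[OF dg_basis_has_derivative, symmetric])
  moreover have "(\<Sum>i\<in>UNIV. p i * (2 / h * axis l 1 $ i) * q i) = 2 / h * p l * q l" for p q :: "'a \<Rightarrow> real" and l
    by (subst sum.remove[of _ l]) (auto simp: axis_def)
  ultimately show ?thesis
    using True by (simp add: grad_def)
next
  case False
  then show ?thesis
    by (auto simp: grad_def dg_basis_other Finite_Cartesian_Product.vec_eq_iff)
qed

lemma continuous_on_poly_cell_map_inv [continuous_intros]:
  "continuous_on S (\<lambda>x. poly p (cell_map_inv a h z x $ i))"
  unfolding cell_map_inv_def by (auto intro!: continuous_intros simp: divide_inverse)

lemma continuous_on_dg_basis [continuous_intros]: "continuous_on S (dg_basis a h s z)"
  by (cases "z = fst s") (auto simp: dg_basis_def intro!: continuous_intros)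

lemma continuous_on_grad_dg_basis [continuous_intros]: "continuous_on S (grad (dg_basis a h s z))"
  unfolding grad_dg_basis divide_inverse by (cases "z = fst s") (auto intro!: continuous_intros)

lemma continuous_on_face_jump [continuous_intros]:
  assumes "\<And>z. continuous_on S (u z)"
  shows "continuous_on S (face_jump N F u)"
  unfolding face_jump_def
  by (cases F; cases "snd F (fst F) = 0"; cases "snd F (fst F) = N (fst F)")
     (use assms in \<open>auto intro!: continuous_intros\<close>)

lemma continuous_on_face_avg [continuous_intros]:
  fixes u :: "('n::finite \<Rightarrow> nat) \<Rightarrow> real ^ 'n \<Rightarrow> 'b::real_normed_vector"
  assumes "\<And>z. continuous_on S (u z)"
  shows "continuous_on S (face_avg N F u)"
  unfolding face_avg_def
  by (cases F; cases "snd F (fst F) = 0"; cases "snd F (fst F) = N (fst F)")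
     (use assms in \<open>auto intro!: continuous_intros\<close>)

section \<open>Expansion of the bilinear form in the basis\<close>

lemma grad_sum:
  assumes "finite S" "\<And>s. s \<in> S \<Longrightarrow> f s differentiable (at x)"
  shows "grad (\<lambda>x. \<Sum>s\<in>S. c s * f s x) x = (\<Sum>s\<in>S. c s *\<^sub>R grad (f s) x)"
proof -
  have "((\<lambda>x. \<Sum>s\<in>S. c s * f s x) has_derivative (\<lambda>v. \<Sum>s\<in>S. c s * frechet_derivative (f s) (at x) v)) (at x)"
    using assms by (intro has_derivative_sum has_derivative_mult_right) (auto simp: frechet_derivative_works)
  from frechet_derivative_at[OF this, symmetric] show ?thesis
    by (simp add: grad_def Finite_Cartesian_Product.vec_eq_iff)
qed

lemma face_avg_sum:
  "face_avg N F (\<lambda>z x. \<Sum>s\<in>S. c s *\<^sub>R u s z x) x = (\<Sum>s\<in>S. c s *\<^sub>R face_avg N F (u s) x)"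
  by (auto simp: face_avg_def sum.distrib scaleR_sum_right scaleR_add_right mult.commute split: prod.splits)

lemma face_jump_sum:
  "face_jump N F (\<lambda>z x. \<Sum>s\<in>S. c s * u s z x) x = (\<Sum>s\<in>S. c s * face_jump N F (u s) x)"
  by (auto simp: face_jump_def sum_subtractf right_diff_distrib split: prod.splits)

lemma inner_sum_sum_scaleR:
  fixes f g :: "'s \<Rightarrow> 'b::real_inner"
  shows "(\<Sum>s\<in>S. c s *\<^sub>R f s) \<bullet> (\<Sum>t\<in>S. c t *\<^sub>R g t) = (\<Sum>(s, t)\<in>S \<times> S. c s * c t * (f s \<bullet> g t))"
  by (simp add: inner_sum_left inner_sum_right sum_distrib_left mult.assoc flip: sum.cartesian_product)
     (subst sum.swap, simp add: mult_ac)

lemma mult_sum_sum: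
  fixes f g :: "'s \<Rightarrow> real"
  shows "(\<Sum>s\<in>S. c s * f s) * (\<Sum>t\<in>S. c t * g t) = (\<Sum>(s, t)\<in>S \<times> S. c s * c t * (f s * g t))"
  using inner_sum_sum_scaleR[of c f S g] by simp

lemma dg_form_commute: "dg_form \<alpha> a h N k u v = dg_form \<alpha> a h N k v u"
  by (simp add: dg_form_def inner_commute mult.commute)

lemma sum_quadratic_form:
  fixes c :: "'s \<Rightarrow> real" and \<kappa> :: real
  shows "(\<Sum>y\<in>Y. \<kappa> * (\<Sum>(s, t)\<in>S \<times> S. c s * c t * f y s t)) =
     (\<Sum>(s, t)\<in>S \<times> S. c s * c t * (\<Sum>y\<in>Y. \<kappa> * f y s t))"
  unfolding sum_distrib_left case_prod_unfold
  by (subst sum.swap) (simp add: mult.left_commute)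

text \<open>This links the form to its Gram matrix, so that coercivity on functions becomes positive
  semidefiniteness of the matrix. Gradients, averages and jumps are linear, and continuity of all
  traces allows the sums to leave the integrals.\<close>

lemma dg_form_sum_basis:
  fixes S :: "(('n::finite \<Rightarrow> nat) \<times> ('n \<Rightarrow> nat)) set" and c :: "_ \<Rightarrow> real" and a h
  assumes "finite S"
  defines "u \<equiv> \<lambda>z x. \<Sum>s\<in>S. c s * dg_basis a h s z x"
  shows "dg_form \<alpha> a h N k u u =
    (\<Sum>(s, t)\<in>S \<times> S. c s * c t * dg_form \<alpha> a h N k (dg_basis a h s) (dg_basis a h t))"
proof -
  let ?b = "dg_basis a h"
  let ?g = "\<lambda>F s x. face_avg N F (\<lambda>z. grad (?b s z)) x \<bullet> face_normal F"
  have gu: "grad (u z) = (\<lambda>x. \<Sum>s\<in>S. c s *\<^sub>R grad (?b s z) x)" for z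
    unfolding u_def by (intro ext grad_sum assms dg_basis_differentiable)
  have cell: "cell_integral a h z (\<lambda>x. grad (u z) x \<bullet> grad (u z) x) =
      (\<Sum>(s, t)\<in>S \<times> S. c s * c t * cell_integral a h z (\<lambda>x. grad (?b s z) x \<bullet> grad (?b t z) x))" for z
    unfolding gu inner_sum_sum_scaleR case_prod_unfold
    by (intro cell_integral_sum continuous_intros)
  have jump: "face_jump N F u x = (\<Sum>s\<in>S. c s * face_jump N F (?b s) x)" for F x
    unfolding u_def by (rule face_jump_sum)
  have avg: "face_avg N F (\<lambda>z. grad (u z)) x \<bullet> face_normal F = (\<Sum>s\<in>S. c s * ?g F s x)" for F x
    unfolding gu face_avg_sum inner_sum_left by simp
  have avg_jump: "face_integral a h F (\<lambda>x. (\<Sum>s\<in>S. c s * ?g F s x) * (\<Sum>s\<in>S. c s * face_jump N F (?b s) x)) =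
      (\<Sum>(s, t)\<in>S \<times> S. c s * c t * face_integral a h F (\<lambda>x. ?g F s x * face_jump N F (?b t) x))" for F
    unfolding mult_sum_sum case_prod_unfold
    by (intro face_integral_sum continuous_intros)
  have jump_jump: "face_integral a h F (\<lambda>x. (\<Sum>s\<in>S. c s * face_jump N F (?b s) x) * (\<Sum>s\<in>S. c s * face_jump N F (?b s) x)) =
      (\<Sum>(s, t)\<in>S \<times> S. c s * c t * face_integral a h F (\<lambda>x. face_jump N F (?b s) x * face_jump N F (?b t) x))" for F
    unfolding mult_sum_sum case_prod_unfold
    by (intro face_integral_sum continuous_intros)
  let ?X1 = "\<lambda>s t. \<Sum>z\<in>cells N. cell_integral a h z (\<lambda>x. grad (?b s z) x \<bullet> grad (?b t z) x)"
  let ?X2 = "\<lambda>s t. \<Sum>F\<in>faces N. face_integral a h F (\<lambda>x. ?g F s x * face_jump N F (?b t) x)"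
  let ?X4 = "\<lambda>s t. \<Sum>F\<in>faces N. \<alpha> * (real k)\<^sup>2 / h *
      face_integral a h F (\<lambda>x. face_jump N F (?b s) x * face_jump N F (?b t) x)"
  let ?D = "\<lambda>X. \<Sum>(s, t)\<in>S \<times> S. c s * c t * X s t"
  have "dg_form \<alpha> a h N k u u = ?D ?X1 - ?D ?X2 - ?D ?X2 + ?D ?X4"
    unfolding dg_form_def avg jump cell avg_jump jump_jump sum_quadratic_form
      sum_quadratic_form[where \<kappa> = 1, simplified] ..
  \<comment> \<open>With both arguments equal to \<open>u\<close> the two consistency terms have the
    same expansion. Relabelling the pair of indices in one of them restores the symmetric shape that
    \<open>dg_form\<close> has on two basis functions.\<close>
  also have "\<dots> = ?D ?X1 - ?D ?X2 - ?D (\<lambda>s t. ?X2 t s) + ?D ?X4"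
  proof -
    have "?D ?X2 = ?D (\<lambda>s t. ?X2 t s)"
      unfolding sum.cartesian_product[symmetric] by (subst sum.swap) (simp add: mult.commute)
    then show ?thesis by (simp only:)
  qed
  also have "\<dots> = ?D (\<lambda>s t. dg_form \<alpha> a h N k (?b s) (?b t))"
    by (simp only: dg_form_def sum_subtractf sum.distrib ring_distribs case_prod_unfold)
  finally show ?thesis .
qed

lemma finite_cells: "finite (cells N)"
proof -
  have "cells N = PiE UNIV (\<lambda>i. {..<N i})"
    by (auto simp: cells_def PiE_UNIV_domain)
  then show ?thesis by (simp add: finite_PiE)
qed

lemma finite_dg_index: "finite (dg_index (N :: 'a::finite \<Rightarrow> nat) k)"
proof -
  have "{\<sigma> :: 'a \<Rightarrow> nat. \<forall>i. \<sigma> i \<le> k} = PiE UNIV (\<lambda>i. {..k})"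
    by (auto simp: PiE_UNIV_domain)
  then have "finite {\<sigma> :: 'a \<Rightarrow> nat. \<forall>i. \<sigma> i \<le> k}"
    by (simp only:) (simp add: finite_PiE)
  then show ?thesis
    by (simp add: dg_index_def finite_cells)
qed

lemma finite_faces: "finite (faces N)"
proof (rule finite_subset)
  show "faces N \<subseteq> UNIV \<times> PiE UNIV (\<lambda>i. {..N i})"
  proof (intro subsetI, clarsimp simp: faces_def PiE_UNIV_domain)
    fix i j z assume "z i \<le> N i" "\<forall>j. j \<noteq> i \<longrightarrow> z j < N j"
    then show "z j \<le> N j" by (cases "j = i") (auto intro: less_imp_le)
  qed
qed (simp add: finite_PiE)

section \<open>Exact mass and DG norm of a basis function\<close>

lemma set_integral_poly_cell:
  assumes "0 < h"
  shows "(LINT t:{a + real n * h .. a + (real n + 1) * h}|lborel. poly p (2 * (t - (a + real n * h)) / h - 1))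
     = h / 2 * unit_integral p"
proof -
  have "a + (real n + 1) * h = a + real n * h + h" by (simp add: algebra_simps)
  then show ?thesis by (simp only: set_integral_poly_affine[OF assms])
qed

lemma set_integrable_poly_affine:
  "set_integrable lborel {l..r} (\<lambda>t::real. poly p (2 * (t - c) / h - 1))"
  unfolding divide_inverse by (intro borel_integrable_atLeastAtMost') (auto intro!: continuous_intros)

lemma cell_integral_poly_prod:
  assumes "0 < h"
  shows "cell_integral a h z (\<lambda>x. \<Prod>i\<in>UNIV. poly (p i) (cell_map_inv a h z x $ i)) =
    (\<Prod>i\<in>UNIV. h / 2 * unit_integral (p i))"
  using cell_integral_prod[of a z h "\<lambda>i t. poly (p i) (2 * (t - (a $ i + real (z i) * h)) / h - 1)"]
  by (simp only: cell_map_inv_def vec_lambda_beta set_integrable_poly_affine set_integral_poly_cell[OF assms])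

text \<open>For \<open>l = z i\<close> and \<open>l = Suc (z i)\<close> the argument of
  \<open>p i\<close> is -1 and 1, an endpoint of the reference interval. One formula thus covers the
  lower and the upper face of the cell \<open>z\<close>.\<close>

lemma face_integral_poly_prod:
  assumes "0 < h"
  shows "face_integral a h (i, z(i := l)) (\<lambda>x. \<Prod>j\<in>UNIV. poly (p j) (cell_map_inv a h z x $ j)) =
    poly (p i) (2 * (real l - real (z i)) - 1) * (\<Prod>j\<in>UNIV - {i}. h / 2 * unit_integral (p j))"
proof -
  let ?f = "\<lambda>j t. poly (p j) (2 * (t - (a $ j + real (z j) * h)) / h - 1)"
  have "face_integral a h (i, z(i := l)) (\<lambda>x. \<Prod>j\<in>UNIV. poly (p j) (cell_map_inv a h z x $ j)) =
    ?f i (a $ i + real ((z(i := l)) i) * h) *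
    (\<Prod>j\<in>UNIV - {i}. LINT t:{a $ j + real ((z(i := l)) j) * h .. a $ j + (real ((z(i := l)) j) + 1) * h}|lborel. ?f j t)"
    unfolding cell_map_inv_def vec_lambda_beta
    by (rule face_integral_prod) (rule set_integrable_poly_affine)
  also have "(\<Prod>j\<in>UNIV - {i}. LINT t:{a $ j + real ((z(i := l)) j) * h .. a $ j + (real ((z(i := l)) j) + 1) * h}|lborel. ?f j t)
     = (\<Prod>j\<in>UNIV - {i}. h / 2 * unit_integral (p j))"
  proof (intro prod.cong refl)
    fix j assume "j \<in> UNIV - {i}"
    then have "(z(i := l)) j = z j" by simp
    then show "(LINT t:{a $ j + real ((z(i := l)) j) * h .. a $ j + (real ((z(i := l)) j) + 1) * h}|lborel. ?f j t) =
        h / 2 * unit_integral (p j)"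
      by (simp only: set_integral_poly_cell[OF assms])
  qed
  also have "?f i (a $ i + real ((z(i := l)) i) * h) = poly (p i) (2 * (real l - real (z i)) - 1)"
  proof -
    have "2 * (a $ i + real ((z(i := l)) i) * h - (a $ i + real (z i) * h)) / h - 1 = 2 * (real l - real (z i)) - 1"
      using assms by (simp add: field_simps)
    then show ?thesis by (simp only:)
  qed
  finally show ?thesis .
qed

lemma dg_basis_square:
  "dg_basis a h s (fst s) x * dg_basis a h s (fst s) x =
     (\<Prod>i\<in>UNIV. poly (legendre (snd s i) * legendre (snd s i)) (cell_map_inv a h (fst s) x $ i))"
  by (simp add: dg_basis_def prod.distrib)

lemma half_unit_integral_legendre_square:
  "h / 2 * unit_integral (legendre n * legendre n) = h / (2 * real n + 1)"
  by (simp add: unit_integral_legendre_square)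

lemma l2_form_dg_basis:
  assumes "0 < h" "fst s \<in> cells N"
  shows "l2_form a h N (dg_basis a h s) (dg_basis a h s) = (\<Prod>i\<in>UNIV. h / (2 * real (snd s i) + 1))"
proof -
  have "l2_form a h N (dg_basis a h s) (dg_basis a h s) =
      cell_integral a h (fst s) (\<lambda>x. dg_basis a h s (fst s) x * dg_basis a h s (fst s) x)"
    unfolding l2_form_def by (subst sum.remove[OF finite_cells assms(2)])
      (simp add: dg_basis_other cell_integral_def)
  then show ?thesis
    unfolding dg_basis_square cell_integral_poly_prod[OF assms(1)] half_unit_integral_legendre_square .
qed

lemma sum_cell_integral_grad_dg_basis:
  assumes h: "0 < h" and s: "fst s \<in> cells N"
  shows "(\<Sum>z\<in>cells N. cell_integral a h z (\<lambda>x. (norm (grad (dg_basis a h s z) x))\<^sup>2)) =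
    (\<Sum>i\<in>UNIV. 2 / h * (real (snd s i) * (real (snd s i) + 1)) *
       (\<Prod>j\<in>UNIV - {i}. h / (2 * real (snd s j) + 1)))"
proof -
  let ?l = "\<lambda>i. legendre (snd s i)" and ?\<xi> = "\<lambda>x. cell_map_inv a h (fst s) x"
  \<comment> \<open>Each squared gradient component is again a tensor product. The factor
    \<open>4 / h^2\<close> is the square of the chain-rule factor \<open>2 / h\<close>; after the
    Jacobian \<open>h / 2\<close> it leaves \<open>2 / h\<close>.\<close>
  let ?q = "\<lambda>i j. if j = i then Polynomial.smult (4 / h\<^sup>2) (pderiv (?l j) * pderiv (?l j)) else ?l j * ?l j"
  have "(norm (grad (dg_basis a h s (fst s)) x))\<^sup>2 =
      (\<Sum>i\<in>UNIV. 1 * (\<Prod>j\<in>UNIV. poly (?q i j) (?\<xi> x $ j)))" for x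
  proof -
    have "(norm (grad (dg_basis a h s (fst s)) x))\<^sup>2 = (\<Sum>i\<in>UNIV. (grad (dg_basis a h s (fst s)) x $ i)\<^sup>2)"
      by (simp add: norm_vec_def L2_set_def sum_nonneg)
    also have "\<dots> = (\<Sum>i\<in>UNIV. 1 * (\<Prod>j\<in>UNIV. poly (?q i j) (?\<xi> x $ j)))"
    proof (intro sum.cong refl)
      fix i
      have "(\<Prod>j\<in>UNIV. poly (?q i j) (?\<xi> x $ j)) = poly (?q i i) (?\<xi> x $ i) *
          (\<Prod>j\<in>UNIV - {i}. poly (?q i j) (?\<xi> x $ j))"
        by (rule prod.remove) auto
      also have "(\<Prod>j\<in>UNIV - {i}. poly (?q i j) (?\<xi> x $ j)) = (\<Prod>j\<in>UNIV - {i}. poly (?l j) (?\<xi> x $ j))\<^sup>2"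
        unfolding power2_eq_square prod.distrib[symmetric] by (intro prod.cong) auto
      finally show "(grad (dg_basis a h s (fst s)) x $ i)\<^sup>2 = 1 * (\<Prod>j\<in>UNIV. poly (?q i j) (?\<xi> x $ j))"
        by (simp add: grad_dg_basis power_mult_distrib power_divide power2_eq_square)
    qed
    finally show ?thesis .
  qed
  then have "cell_integral a h (fst s) (\<lambda>x. (norm (grad (dg_basis a h s (fst s)) x))\<^sup>2) =
      (\<Sum>i\<in>UNIV. 1 * cell_integral a h (fst s) (\<lambda>x. \<Prod>j\<in>UNIV. poly (?q i j) (?\<xi> x $ j)))"
    by (simp only:) (intro cell_integral_sum continuous_on_prod continuous_on_poly_cell_map_inv)
  also have "\<dots> = (\<Sum>i\<in>UNIV. 2 / h * (real (snd s i) * (real (snd s i) + 1)) *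
       (\<Prod>j\<in>UNIV - {i}. h / (2 * real (snd s j) + 1)))"
  proof (intro sum.cong refl)
    fix i
    have "(\<Prod>j\<in>UNIV. h / 2 * unit_integral (?q i j)) =
        h / 2 * unit_integral (?q i i) * (\<Prod>j\<in>UNIV - {i}. h / 2 * unit_integral (?q i j))"
      by (rule prod.remove) auto
    also have "(\<Prod>j\<in>UNIV - {i}. h / 2 * unit_integral (?q i j)) = (\<Prod>j\<in>UNIV - {i}. h / (2 * real (snd s j) + 1))"
      by (intro prod.cong) (auto simp: unit_integral_legendre_square)
    also have "h / 2 * unit_integral (?q i i) = 2 / h * (real (snd s i) * (real (snd s i) + 1))"
      using h by (simp add: unit_integral_smult unit_integral_legendre_pderiv_square power2_eq_square)
    finally show "1 * cell_integral a h (fst s) (\<lambda>x. \<Prod>j\<in>UNIV. poly (?q i j) (?\<xi> x $ j)) =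
        2 / h * (real (snd s i) * (real (snd s i) + 1)) * (\<Prod>j\<in>UNIV - {i}. h / (2 * real (snd s j) + 1))"
      by (simp only: cell_integral_poly_prod[OF h] mult_1_left)
  qed
  finally have "cell_integral a h (fst s) (\<lambda>x. (norm (grad (dg_basis a h s (fst s)) x))\<^sup>2) =
     (\<Sum>i\<in>UNIV. 2 / h * (real (snd s i) * (real (snd s i) + 1)) *
       (\<Prod>j\<in>UNIV - {i}. h / (2 * real (snd s j) + 1)))" .
  moreover have "cell_integral a h z (\<lambda>x. (norm (grad (dg_basis a h s z) x))\<^sup>2) = 0" if "z \<noteq> fst s" for z
    using that by (simp add: grad_dg_basis cell_integral_def norm_vec_def L2_set_def)
  ultimately show ?thesis
    by (subst sum.remove[OF finite_cells s]) simp
qed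

text \<open>A basis function has its only nonzero trace from the cell \<open>fst s\<close>. Its jump
  on the lower or upper face of that cell is this trace up to sign, so squaring removes both the
  orientation and the boundary case.\<close>

lemma face_jump_dg_basis_square:
  assumes "(i, z) \<in> faces N" "fst s \<in> cells N"
  shows "(face_jump N (i, z) (dg_basis a h s) x)\<^sup>2 =
    (if z = fst s \<or> z = (fst s)(i := Suc (fst s i))
     then dg_basis a h s (fst s) x * dg_basis a h s (fst s) x else 0)"
proof -
  have lt: "fst s i < N i" using assms by (auto simp: cells_def)
  have eq: "z(i := z i - 1) = fst s \<longleftrightarrow> z = (fst s)(i := Suc (fst s i))" if "z i \<noteq> 0"
    using that by (auto simp: fun_eq_iff)
  consider "z i = 0" | "z i \<noteq> 0" "z i = N i" | "z i \<noteq> 0" "z i \<noteq> N i" by blast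
  then show ?thesis
  proof cases
    case 1
    then show ?thesis
      by (cases "z = fst s") (auto simp: face_jump_def power2_eq_square dg_basis_other)
  next
    case 2
    then have "z \<noteq> fst s" using lt by auto
    with 2 show ?thesis
      using eq by (cases "z(i := z i - 1) = fst s") (auto simp: face_jump_def power2_eq_square dg_basis_other)
  next
    case 3
    have "z(i := z i - 1) \<noteq> z" using 3 by (auto simp: fun_eq_iff)
    with 3 show ?thesis
      using eq by (cases "z(i := z i - 1) = fst s"; cases "z = fst s")
        (auto simp: face_jump_def power2_eq_square dg_basis_other)
  qed
qed

text \<open>Only the lower faces \<open>?L\<close> and upper faces \<open>?U\<close> of the support
  cell contribute. The factor in the normal direction is one at both endpoints, which leaves the
  tangential mass twice for each axis.\<close>

lemma sum_face_integral_jump_dg_basis: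
  assumes h: "0 < h" and s: "fst s \<in> cells N"
  shows "(\<Sum>F\<in>faces N. face_integral a h F (\<lambda>x. (face_jump N F (dg_basis a h s) x)\<^sup>2)) =
    (\<Sum>i\<in>UNIV. 2 * (\<Prod>j\<in>UNIV - {i}. h / (2 * real (snd s j) + 1)))"
proof -
  define z where "z = fst s"
  have lt: "z i < N i" for i using s by (auto simp: cells_def z_def)
  let ?I = "\<lambda>F. face_integral a h F (\<lambda>x. (face_jump N F (dg_basis a h s) x)\<^sup>2)"
  let ?L = "range (\<lambda>i. (i, z))" and ?U = "range (\<lambda>i. (i, z(i := Suc (z i))))"
  let ?p = "\<lambda>i. \<Prod>j\<in>UNIV - {i}. h / (2 * real (snd s j) + 1)"
  have sub: "?L \<union> ?U \<subseteq> faces N"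
    using lt by (auto simp: faces_def Suc_le_eq less_imp_le)
  have zero: "?I F = 0" if "F \<in> faces N - (?L \<union> ?U)" for F
  proof -
    obtain i y where F: "F = (i, y)" by (cases F)
    have "(face_jump N F (dg_basis a h s) x)\<^sup>2 = 0" for x
      using that unfolding F by (subst face_jump_dg_basis_square[OF _ s]) (auto simp: z_def)
    then show ?thesis by (simp add: F face_integral_def)
  qed
  have I: "?I (i, z(i := l)) = ?p i" if "l = z i \<or> l = Suc (z i)" for i l
  proof -
    have mem: "(i, z(i := l)) \<in> faces N"
      using that lt by (auto simp: faces_def Suc_le_eq less_imp_le)
    have cond: "z(i := l) = fst s \<or> z(i := l) = (fst s)(i := Suc (fst s i))"
      using that by (auto simp: z_def)
    have "?I (i, z(i := l)) = face_integral a h (i, z(i := l))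
        (\<lambda>x. \<Prod>j\<in>UNIV. poly (legendre (snd s j) * legendre (snd s j)) (cell_map_inv a h z x $ j))"
      unfolding face_jump_dg_basis_square[OF mem s] if_P[OF cond] dg_basis_square by (simp only: z_def)
    also have "\<dots> = poly (legendre (snd s i) * legendre (snd s i)) (2 * (real l - real (z i)) - 1) * ?p i"
      unfolding face_integral_poly_prod[OF h] half_unit_integral_legendre_square ..
    also have "poly (legendre (snd s i) * legendre (snd s i)) (2 * (real l - real (z i)) - 1) = 1"
      using that by (auto simp flip: power_mult_distrib)
    finally show ?thesis by (simp only: mult_1_left)
  qed
  have "(\<Sum>F\<in>faces N. ?I F) = (\<Sum>F\<in>?L \<union> ?U. ?I F)"
    using zero by (intro sum.mono_neutral_right finite_faces sub) blast
  also have "\<dots> = (\<Sum>F\<in>?L. ?I F) + (\<Sum>F\<in>?U. ?I F)"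
  proof (intro sum.union_disjoint)
    have "z \<noteq> z(i := Suc (z i))" for i
      by (metis fun_upd_same n_not_Suc_n)
    then show "?L \<inter> ?U = {}" by auto
  qed auto
  also have "(\<Sum>F\<in>?L. ?I F) = (\<Sum>i\<in>UNIV. ?p i)"
    using I[of "z i" i for i] by (subst sum.reindex) (auto simp: inj_on_def)
  also have "(\<Sum>F\<in>?U. ?I F) = (\<Sum>i\<in>UNIV. ?p i)"
    using I[of "Suc (z i)" i for i] by (subst sum.reindex) (auto simp: inj_on_def)
  finally show ?thesis by (simp add: sum_distrib_left[symmetric])
qed

lemma dg_norm_dg_basis:
  assumes "0 < h" "fst s \<in> cells N"
  shows "(dg_norm a h N k (dg_basis a h s))\<^sup>2 =
    (\<Sum>i\<in>UNIV. (2 / h * (real (snd s i) * (real (snd s i) + 1)) + 2 * (real k)\<^sup>2 / h) *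
       (\<Prod>j\<in>UNIV - {i}. h / (2 * real (snd s j) + 1)))"
proof -
  have "0 \<le> (\<Sum>i\<in>UNIV. 2 / h * (real (snd s i) * (real (snd s i) + 1)) *
       (\<Prod>j\<in>UNIV - {i}. h / (2 * real (snd s j) + 1))) +
    (real k)\<^sup>2 / h * (\<Sum>i\<in>UNIV. 2 * (\<Prod>j\<in>UNIV - {i}. h / (2 * real (snd s j) + 1)))"
    using assms(1) by (intro add_nonneg_nonneg sum_nonneg mult_nonneg_nonneg prod_nonneg) auto
  then show ?thesis
    unfolding dg_norm_def sum_cell_integral_grad_dg_basis[OF assms] sum_face_integral_jump_dg_basis[OF assms]
    by (simp add: sum_distrib_left ring_distribs sum.distrib mult_ac)
qed

text \<open>The jump term keeps the norm positive even for the constant basis function, whose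
  gradient vanishes. Together with coercivity this makes the diagonal of the stiffness matrix
  positive.\<close>

lemma dg_norm_dg_basis_pos:
  assumes "0 < h" "fst s \<in> cells N" "1 \<le> k"
  shows "0 < (dg_norm a h N k (dg_basis a h s))\<^sup>2"
  unfolding dg_norm_dg_basis[OF assms(1,2)]
  using assms(1,3) by (intro sum_pos mult_pos_pos prod_pos add_nonneg_pos) (auto intro!: divide_pos_pos add_nonneg_pos)

text \<open>Removing direction \<open>i\<close> from the mass costs a factor
  \<open>(2 \<sigma> + 1) / h\<close>, of order \<open>k / h\<close>. It multiplies the gradient and
  penalty factors, both of order \<open>k^2 / h\<close>, in each of the \<open>CARD('n)\<close>
  directions.\<close>

lemma dg_norm_dg_basis_le:
  fixes s :: "('n::finite \<Rightarrow> nat) \<times> ('n \<Rightarrow> nat)"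
  assumes "0 < h" "s \<in> dg_index N k" "1 \<le> k"
  shows "(dg_norm a h N k (dg_basis a h s))\<^sup>2 \<le>
    18 * real CARD('n) * (real k ^ 3 / h\<^sup>2) * l2_form a h N (dg_basis a h s) (dg_basis a h s)"
proof -
  have s: "fst s \<in> cells N" and le: "snd s i \<le> k" for i
    using assms(2) by (auto simp: dg_index_def)
  define m where "m = (\<Prod>i\<in>UNIV. h / (2 * real (snd s i) + 1))"
  let ?p = "\<lambda>i. \<Prod>j\<in>UNIV - {i}. h / (2 * real (snd s j) + 1)"
  have m: "?p i = (2 * real (snd s i) + 1) / h * m" for i
  proof -
    have "m = h / (2 * real (snd s i) + 1) * ?p i"
      unfolding m_def by (rule prod.remove) auto
    moreover have "2 * real (snd s i) + 1 \<noteq> 0" by linarith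
    ultimately show ?thesis using assms(1) by simp
  qed
  have "0 \<le> m" unfolding m_def using assms(1) by (intro prod_nonneg) auto
  have "(2 / h * (real (snd s i) * (real (snd s i) + 1)) + 2 * (real k)\<^sup>2 / h) * ?p i \<le>
      18 * (real k ^ 3 / h\<^sup>2) * m" for i
  proof -
    let ?\<sigma> = "real (snd s i)" and ?k = "real k"
    have "?\<sigma> \<le> ?k" "1 \<le> ?k" using le assms(3) by auto
    \<comment> \<open>The constant 18 is 6 times 3: the bracket is at most
      \<open>2 * 2 k^2 + 2 k^2\<close>, and \<open>2 \<sigma> + 1\<close> is at most
      \<open>3 k\<close>.\<close>
    then have "?\<sigma> * (?\<sigma> + 1) \<le> ?k * (2 * ?k)"
      by (intro mult_mono) auto
    moreover have "2 * ?\<sigma> + 1 \<le> 3 * ?k"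
      using \<open>?\<sigma> \<le> ?k\<close> \<open>1 \<le> ?k\<close> by linarith
    ultimately have "(2 * (?\<sigma> * (?\<sigma> + 1)) + 2 * ?k\<^sup>2) * (2 * ?\<sigma> + 1) \<le> (6 * ?k\<^sup>2) * (3 * ?k)"
      by (intro mult_mono) (auto simp: power2_eq_square)
    also have "\<dots> = 18 * ?k ^ 3" by (simp add: power2_eq_square power3_eq_cube)
    finally have "(2 * (?\<sigma> * (?\<sigma> + 1)) + 2 * ?k\<^sup>2) * (2 * ?\<sigma> + 1) * (m / h\<^sup>2) \<le> 18 * ?k ^ 3 * (m / h\<^sup>2)"
      using \<open>0 \<le> m\<close> by (intro mult_right_mono) auto
    then show ?thesis
      unfolding m using assms(1) by (simp add: field_simps power2_eq_square)
  qed
  then have "(dg_norm a h N k (dg_basis a h s))\<^sup>2 \<le> (\<Sum>i\<in>(UNIV :: 'n set). 18 * (real k ^ 3 / h\<^sup>2) * m)"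
    unfolding dg_norm_dg_basis[OF assms(1) s] by (intro sum_mono) auto
  then show ?thesis
    by (simp add: l2_form_dg_basis[OF assms(1) s] m_def mult_ac)
qed

section \<open>Positivity of the stiffness matrix and the final estimate\<close>

lemma bij_betw_dg_index: "bij_betw (from_nat_into (dg_index N k)) {..<dg_dim N k} (dg_index N k)"
  unfolding dg_dim_def by (rule bij_betw_from_nat_into_finite[OF finite_dg_index])

lemma dg_basis_in_dg_space:
  assumes "s \<in> dg_index N k"
  shows "dg_basis a h s \<in> dg_space a h N k"
proof -
  have "dg_basis a h s = (\<lambda>z x. \<Sum>t\<in>dg_index N k. (if t = s then 1 else 0) * dg_basis a h t z x)"
    using assms by (simp add: sum.delta[OF finite_dg_index] if_distrib[of "\<lambda>c. c * _"] cong: if_cong)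
  then show ?thesis
    unfolding dg_space_def by (intro CollectI exI[of _ "\<lambda>t. if t = s then 1 else 0"] conjI TrueI)
qed

text \<open>Pulling the coefficients back along the enumeration of the basis turns the matrix sum
  into \<open>dg_form\<close> at the corresponding DG function.\<close>

lemma stiffness_quadratic_form:
  assumes coercive: "\<And>u. u \<in> dg_space a h N k \<Longrightarrow> 0 \<le> dg_form \<alpha> a h N k u u"
  shows "0 \<le> (\<Sum>i<dg_dim N k. \<Sum>j<dg_dim N k. f i * f j * stiffness \<alpha> a h N k $$ (i, j))"
proof -
  let ?S = "dg_index N k" and ?n = "dg_dim N k"
  let ?e = "from_nat_into ?S"
  let ?B = "\<lambda>s t. dg_form \<alpha> a h N k (dg_basis a h s) (dg_basis a h t)"
  note bij = bij_betw_dg_index[of N k]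
  define c where "c = f \<circ> the_inv_into {..<?n} ?e"
  have c: "c (?e i) = f i" if "i < ?n" for i
    using that bij by (simp add: c_def the_inv_into_f_f bij_betw_def)
  have "(\<Sum>i<?n. \<Sum>j<?n. f i * f j * stiffness \<alpha> a h N k $$ (i, j)) =
      (\<Sum>i<?n. \<Sum>j<?n. c (?e i) * c (?e j) * ?B (?e i) (?e j))"
    by (intro sum.cong refl) (simp add: stiffness_def dg_matrix_def c)
  also have "\<dots> = (\<Sum>s\<in>?S. \<Sum>t\<in>?S. c s * c t * ?B s t)"
    by (simp only: sum.reindex_bij_betw[OF bij, of "\<lambda>t. c _ * c t * ?B _ t"]
        sum.reindex_bij_betw[OF bij, of "\<lambda>s. \<Sum>t\<in>?S. c s * c t * ?B s t"])
  also have "\<dots> = dg_form \<alpha> a h N k (\<lambda>z x. \<Sum>s\<in>?S. c s * dg_basis a h s z x) (\<lambda>z x. \<Sum>s\<in>?S. c s * dg_basis a h s z x)"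
    unfolding dg_form_sum_basis[OF finite_dg_index] by (simp add: sum.cartesian_product)
  also have "\<dots> \<ge> 0"
    by (rule coercive) (auto simp: dg_space_def)
  finally show ?thesis .
qed

text \<open>The lower bound with \<open>c\<^sub>1\<close> makes \<open>1 / \<omega>\<close> of order
  \<open>k\<close>. With the \<open>k^3 / h^2\<close> from the ratio of diagonal to mass this gives
  \<open>k^4 / h^2\<close>, the square of the claimed factor.\<close>

theorem lemma4p5:
  fixes a b :: "real ^ 'n::finite" and \<alpha>\<^sub>0 c\<^sub>1 c\<^sub>2 :: real
  assumes "\<And>i. a $ i < b $ i"
    and "0 < \<alpha>\<^sub>0" and "uniformly_stable_penalty a b \<alpha>\<^sub>0"
    and "0 < c\<^sub>1" and "0 < c\<^sub>2"
  shows "\<exists>C>0. \<forall>(h::real) (N::'n \<Rightarrow> nat) (p::nat) (k::nat) (m::nat) (\<omega>::real).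
    uniform_mesh a b h N \<longrightarrow> k \<in> {2..p} \<longrightarrow> 1 \<le> m \<longrightarrow>
    (let A = stiffness \<alpha>\<^sub>0 a h N k;
         M = mass a h N k;
         X = diag_powr (diag_part A) (- 1) * A
     in 0 < \<omega> * mat_spectral_radius X \<longrightarrow> \<omega> * mat_spectral_radius X \<le> 1 \<longrightarrow>
        \<omega> \<le> c\<^sub>2 / (real k + 1) \<longrightarrow> c\<^sub>1 / (real k + 1) \<le> \<omega> \<longrightarrow>
        (\<forall>g \<in> carrier_vec (dg_dim N k).
           energy_norm A 0 ((diag_powr M (- 1/2) * A * poly_mat (cheb4 m) (\<omega> \<cdot>\<^sub>m X)) *\<^sub>v g)
           \<le> C * ((real k)\<^sup>2 / (h * real m)) * energy_norm A 1 g))"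
proof -
  obtain \<gamma> \<Gamma> where \<gamma>: "0 < \<gamma>" and \<Gamma>: "0 < \<Gamma>"
    and coercive: "\<And>h N k u. uniform_mesh a b h N \<Longrightarrow> 1 \<le> k \<Longrightarrow> u \<in> dg_space a h N k \<Longrightarrow>
        \<gamma> * (dg_norm a h N k u)\<^sup>2 \<le> dg_form \<alpha>\<^sub>0 a h N k u u"
    and continuous: "\<And>h N k u v. uniform_mesh a b h N \<Longrightarrow> 1 \<le> k \<Longrightarrow> u \<in> dg_space a h N k \<Longrightarrow>
        v \<in> dg_space a h N k \<Longrightarrow> \<bar>dg_form \<alpha>\<^sub>0 a h N k u v\<bar> \<le> \<Gamma> * dg_norm a h N k u * dg_norm a h N k v"
    using assms(3) unfolding uniformly_stable_penalty_def by metis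
  \<comment> \<open>Under the root, \<open>\<Gamma>\<close> is the continuity constant, 18 times the
    dimension comes from \<open>dg_norm_dg_basis_le\<close>, and the remaining
    \<open>2 / c\<^sub>1\<close> from
    \<open>1 / \<omega> \<le> (k + 1) / c\<^sub>1 \<le> 2 k / c\<^sub>1\<close>.\<close>
  define C where "C = sqrt (36 * \<Gamma> * real CARD('n) / c\<^sub>1)"
  have "0 < C" using \<Gamma> assms(4) by (simp add: C_def)
  have bound: "energy_norm A 0 ((diag_powr M (- 1/2) * A * poly_mat (cheb4 m) (\<omega> \<cdot>\<^sub>m X)) *\<^sub>v g)
      \<le> C * ((real k)\<^sup>2 / (h * real m)) * energy_norm A 1 g"
    if mesh: "uniform_mesh a b h N" and k: "k \<in> {2..p}" and m: "1 \<le> m"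
      and A_eq: "A = stiffness \<alpha>\<^sub>0 a h N k" and M_eq: "M = mass a h N k"
      and X_eq: "X = diag_powr (diag_part A) (- 1) * A"
      and \<rho>: "\<omega> * mat_spectral_radius X \<le> 1" and \<omega>_ge: "c\<^sub>1 / (real k + 1) \<le> \<omega>"
      and g: "g \<in> carrier_vec (dg_dim N k)"
    for h N p k m \<omega> A M X g
  proof -
    let ?n = "dg_dim N k" and ?e = "from_nat_into (dg_index N k)"
    have h: "0 < h" using mesh by (simp add: uniform_mesh_def)
    have k1: "1 \<le> k" using k by simp
    have "0 < c\<^sub>1 / (real k + 1)" using assms(4) by (simp add: add_nonneg_pos)
    with \<omega>_ge have \<omega>: "0 < \<omega>" by linarith
    have e: "?e i \<in> dg_index N k" if "i < ?n" for i
      using bij_betw_apply[OF bij_betw_dg_index] that by blast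
    have e_cell: "fst (?e i) \<in> cells N" if "i < ?n" for i
      using e[OF that] by (auto simp: dg_index_def)
    have A: "A \<in> carrier_mat ?n ?n" and M: "M \<in> carrier_mat ?n ?n"
      by (simp_all add: A_eq M_eq stiffness_def mass_def dg_matrix_def)
    have Aij: "A $$ (i, j) = dg_form \<alpha>\<^sub>0 a h N k (dg_basis a h (?e i)) (dg_basis a h (?e j))"
      if "i < ?n" "j < ?n" for i j
      using that by (simp add: A_eq stiffness_def dg_matrix_def)
    have Mii: "M $$ (i, i) = l2_form a h N (dg_basis a h (?e i)) (dg_basis a h (?e i))" if "i < ?n" for i
      using that by (simp add: M_eq mass_def dg_matrix_def)
    define K where "K = \<Gamma> * (18 * real CARD('n) * (real k ^ 3 / h\<^sup>2))"
    have psd: "0 \<le> (\<Sum>i<?n. \<Sum>j<?n. f i * f j * A $$ (i, j))" for f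
      unfolding A_eq
    proof (rule stiffness_quadratic_form)
      fix u assume "u \<in> dg_space a h N k"
      from coercive[OF mesh k1 this] \<gamma> show "0 \<le> dg_form \<alpha>\<^sub>0 a h N k u u"
        by (meson mult_nonneg_nonneg order_trans zero_le_power2 less_imp_le)
    qed
    have "(energy_norm A 0 ((diag_powr M (- 1/2) * A * poly_mat (cheb4 m) (\<omega> \<cdot>\<^sub>m X)) *\<^sub>v g))\<^sup>2
        \<le> K / (\<omega> * (2 * real m + 1)\<^sup>2) * (energy_norm A 1 g)\<^sup>2"
    proof (rule cheb4_matrix_smoothing[OF A M _ psd _ _ _ X_eq \<omega> \<rho> g])
      show "A $$ (i, j) = A $$ (j, i)" if "i < ?n" "j < ?n" for i j
        using that by (simp add: Aij dg_form_commute)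
      fix i assume i: "i < ?n"
      let ?b = "dg_basis a h (?e i)"
      have b: "?b \<in> dg_space a h N k" by (rule dg_basis_in_dg_space[OF e[OF i]])
      have "0 < \<gamma> * (dg_norm a h N k ?b)\<^sup>2"
        using dg_norm_dg_basis_pos[OF h e_cell[OF i] k1] \<gamma> by simp
      also have "\<dots> \<le> A $$ (i, i)" unfolding Aij[OF i i] by (rule coercive[OF mesh k1 b])
      finally show "0 < A $$ (i, i)" .
      show "0 < M $$ (i, i)"
        unfolding Mii[OF i] l2_form_dg_basis[OF h e_cell[OF i]] using h
        by (intro prod_pos) (auto intro!: divide_pos_pos add_nonneg_pos)
      have "A $$ (i, i) \<le> \<Gamma> * (dg_norm a h N k ?b)\<^sup>2"
        using continuous[OF mesh k1 b b] unfolding Aij[OF i i] by (simp add: power2_eq_square mult.assoc)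
      also have "\<dots> \<le> \<Gamma> * (18 * real CARD('n) * (real k ^ 3 / h\<^sup>2) * M $$ (i, i))"
        unfolding Mii[OF i] using \<Gamma> by (intro mult_left_mono dg_norm_dg_basis_le[OF h e[OF i] k1]) auto
      finally show "A $$ (i, i) \<le> K * M $$ (i, i)" by (simp add: K_def mult.assoc)
    qed
    also have "\<dots> \<le> (C * ((real k)\<^sup>2 / (h * real m)))\<^sup>2 * (energy_norm A 1 g)\<^sup>2"
    proof (rule mult_right_mono)
      have "1 / \<omega> \<le> (real k + 1) / c\<^sub>1"
        using \<omega> \<omega>_ge assms(4) by (simp add: field_simps)
      also have "\<dots> \<le> 2 * real k / c\<^sub>1"
        using k1 assms(4) by (intro divide_right_mono) auto
      finally have 1: "1 / \<omega> \<le> 2 * real k / c\<^sub>1" .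
      have 2: "1 / (2 * real m + 1)\<^sup>2 \<le> 1 / (real m)\<^sup>2"
        using m by (intro divide_left_mono power_mono mult_pos_pos) auto
      have "0 \<le> K" using \<Gamma> by (simp add: K_def)
      have "K / (\<omega> * (2 * real m + 1)\<^sup>2) = K * (1 / \<omega> * (1 / (2 * real m + 1)\<^sup>2))" by simp
      also have "\<dots> \<le> K * (2 * real k / c\<^sub>1 * (1 / (real m)\<^sup>2))"
        using \<open>0 \<le> K\<close> assms(4) by (intro mult_left_mono mult_mono 1 2) auto
      also have "\<dots> = (36 * \<Gamma> * real CARD('n) / c\<^sub>1) * ((real k)\<^sup>2 / (h * real m))\<^sup>2"
        by (simp add: K_def power2_eq_square power3_eq_cube mult_ac)
      also have "36 * \<Gamma> * real CARD('n) / c\<^sub>1 = C\<^sup>2"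
        using \<Gamma> assms(4) by (simp add: C_def)
      finally show "K / (\<omega> * (2 * real m + 1)\<^sup>2) \<le> (C * ((real k)\<^sup>2 / (h * real m)))\<^sup>2"
        by (simp only: power_mult_distrib)
    qed simp
    finally have "(energy_norm A 0 ((diag_powr M (- 1/2) * A * poly_mat (cheb4 m) (\<omega> \<cdot>\<^sub>m X)) *\<^sub>v g))\<^sup>2
        \<le> (C * ((real k)\<^sup>2 / (h * real m)) * energy_norm A 1 g)\<^sup>2"
      by (simp only: power_mult_distrib)
    \<comment> \<open>Taking roots in the comparison of squares requires a nonnegative right side.
      As \<open>sqrt\<close> is negative on negative numbers, this rests on positive
      semidefiniteness.\<close>
    moreover have "0 \<le> energy_norm A 1 g"
      unfolding energy_norm_1[OF A g] using psd by simp
    then have "0 \<le> C * ((real k)\<^sup>2 / (h * real m)) * energy_norm A 1 g"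
      using \<open>0 < C\<close> h by (intro mult_nonneg_nonneg) auto
    ultimately show ?thesis
      by (rule power2_le_imp_le)
  qed
  show ?thesis
    unfolding Let_def by (intro exI[of _ C] conjI \<open>0 < C\<close> allI impI ballI) (rule bound[OF _ _ _ refl refl refl])
qed

end
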